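(* Fix $0<\delta<\frac12$ and a constant $C>0$. Let $$B^*(N;\delta)=\#\{(\lambda,\lambda')\in\mathbb{Z}^2\times\mathbb{Z}^2:\ \|\lambda\|^2=\|\lambda'\|^2\le N,\ 0<\|\lambda-\lambda'\|\le C\|\lambda\|^{1-2\delta}\}.$$ Then, as $N\to\infty$, $$B^*(N;\delta)=\frac{4C}{\pi}\cdot\frac{1-2\delta}{1-\delta}\cdot N^{1-\delta}\log N\left(1+O\left(\frac{1}{\sqrt{\log N}}\right)\right).$$ *)

theory Defs
  imports "HOL-Analysis.Analysis" "HOL-Library.Landau_Symbols"
begin

definition int_lattice :: "(real \<times> real) set" where
  "int_lattice = \<int> \<times> \<int>"

definition close_pairs :: "real \<Rightarrow> real \<Rightarrow> real \<Rightarrow> ((real \<times> real) \<times> (real \<times> real)) set" where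
  "close_pairs C \<delta> N =
     {(u, v). u \<in> int_lattice \<and> v \<in> int_lattice \<and>
        (norm u)\<^sup>2 = (norm v)\<^sup>2 \<and> (norm v)\<^sup>2 \<le> N \<and>
        0 < norm (u - v) \<and> norm (u - v) \<le> C * norm u powr (1 - 2 * \<delta>)}"

definition Bstar :: "real \<Rightarrow> real \<Rightarrow> real \<Rightarrow> nat" where
  "Bstar C \<delta> N = card (close_pairs C \<delta> N)"

text \<open>The set being counted is finite, so the junk value of \<^const>\<open>card\<close> on infinite sets
  plays no role in \<^const>\<open>Bstar\<close>.\<close>

lemma finite_int_lattice_norm_le: "finite {u \<in> int_lattice. (norm u)\<^sup>2 \<le> N}"
proof -
  let ?I = "{x \<in> \<int>. \<bar>x\<bar> \<le> sqrt N} :: real set"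
  have "?I \<subseteq> of_int ` {\<lfloor>- sqrt N\<rfloor>..\<lceil>sqrt N\<rceil>}"
  proof
    fix x :: real assume x: "x \<in> ?I"
    then obtain k where k: "x = of_int k" by (auto elim: Ints_cases)
    have "- sqrt N \<le> of_int k" "of_int k \<le> sqrt N" using x k by auto
    then have "\<lfloor>- sqrt N\<rfloor> \<le> k" "k \<le> \<lceil>sqrt N\<rceil>" by linarith+
    then show "x \<in> of_int ` {\<lfloor>- sqrt N\<rfloor>..\<lceil>sqrt N\<rceil>}" using k by auto
  qed
  then have fin: "finite ?I" by (rule finite_subset) auto
  have "{u \<in> int_lattice. (norm u)\<^sup>2 \<le> N} \<subseteq> ?I \<times> ?I"
  proof
    fix u assume u: "u \<in> {u \<in> int_lattice. (norm u)\<^sup>2 \<le> N}"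
    have "norm u \<le> sqrt N" using u by (simp add: real_le_rsqrt)
    moreover have "norm (fst u) \<le> norm u" "norm (snd u) \<le> norm u"
      by (metis norm_fst_le prod.collapse) (metis norm_snd_le prod.collapse)
    ultimately show "u \<in> ?I \<times> ?I" using u by (auto simp: int_lattice_def)
  qed
  then show ?thesis using fin by (meson finite_SigmaI finite_subset)
qed

lemma finite_close_pairs: "finite (close_pairs C \<delta> N)"
  by (rule finite_subset[OF _ finite_cartesian_product[OF finite_int_lattice_norm_le finite_int_lattice_norm_le],
        of _ N N]) (auto simp: close_pairs_def)

end

theory Submission
  imports Defs "HOL-Real_Asymp.Real_Asymp"
begin

text \<open>
  Write \<open>u - v = k (a, b)\<close> with \<open>(a, b)\<close> primitive and \<open>k > 0\<close>. Equality of the norms says that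
  \<open>u + v\<close> is orthogonal to \<open>(a, b)\<close>, i.e. \<open>u + v = l (- b, a)\<close>, and the two vectors must be congruent
  mod 2. With \<open>p = \<bar>(a, b)\<bar>\<close>, \<open>X = C N\<^bsup>(1-2\<delta>)/2\<^esup>\<close> and \<open>\<alpha> = 1/(1-2\<delta>)\<close>, the admissible \<open>l\<close> number
  \<open>2 \<surd>N (1 - (k p / X)\<^sup>\<alpha>) / p + O(k)\<close>; summing over \<open>k\<close> leaves \<open>\<surd>N X / (1 - \<delta>)\<close> times the sum of
  \<open>c(a, b) / p\<^sup>2\<close> over primitive vectors of length at most \<open>X\<close>, where the parity condition makes \<open>c = 1\<close>
  if \<open>a\<close> and \<open>b\<close> are odd, and \<open>c = 1/2\<close> otherwise.

  Over all nonzero lattice vectors the sum of \<open>1/p\<^sup>2\<close> is \<open>2 \<pi> ln X + O(1)\<close>. Since every vector is a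
  multiple of a primitive one, monotonicity alone (comparing the cutoffs \<open>X\<close> and \<open>K X\<close> with
  \<open>K \<approx> \<surd>(ln X)\<close>) gives \<open>(12/\<pi>) ln X + O(\<surd>(ln X))\<close> for primitive vectors, without Moebius inversion.
  Multiplication by \<open>1 + i\<close> carries one parity class onto the other; this yields the factor \<open>2/3\<close> for the
  weights \<open>c\<close>.
\<close>

section \<open>One-variable sums: a power profile and the partial sums of zeta(2)\<close>

text \<open>The summand falls from 1 at t = 0 to 0 at t = x, so the sum lies below the integral over
  [0, x] by at most the total drop 1.\<close>

lemma sum_one_minus_powr_bounds:
  fixes x \<alpha> :: real
  assumes x: "x > 0" and \<alpha>: "\<alpha> > 0"
  shows "\<bar>(\<Sum>k=1..nat \<lfloor>x\<rfloor>. 1 - (real k / x) powr \<alpha>) - x * \<alpha> / (\<alpha> + 1)\<bar> \<le> 1"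
proof -
  define f where "f = (\<lambda>t. 1 - (t / x) powr \<alpha>)"
  define F where "F = (\<lambda>t. t - x / (\<alpha> + 1) * (t / x) powr (\<alpha> + 1))"
  have deriv: "(F has_real_derivative f t) (at t)" if "t > 0" for t
  proof -
    have "(F has_real_derivative 1 - x / (\<alpha> + 1) * ((\<alpha> + 1) * (t / x) powr (\<alpha> + 1 - 1) * (1 / x))) (at t)"
      unfolding F_def using x that
      by (auto intro!: derivative_eq_intros simp: powr_diff)
    also have "1 - x / (\<alpha> + 1) * ((\<alpha> + 1) * (t / x) powr (\<alpha> + 1 - 1) * (1 / x)) = f t"
      using x \<alpha> by (simp add: f_def)
    finally show ?thesis .
  qed
  \<comment> \<open>\<open>deriv\<close> covers t > 0 only; at t = 0 the mean value theorem makes do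
    with continuity.\<close>
  have cont: "continuous_on {0..} F"
    unfolding F_def using x \<alpha>
    by (intro continuous_on_diff continuous_on_mult continuous_on_powr' continuous_intros) auto
  have anti: "f t \<le> f s" if "0 \<le> s" "s \<le> t" for s t
    unfolding f_def using that x \<alpha> by (auto intro!: powr_mono2 divide_right_mono)
  have mvt: "f t * (t - s) \<le> F t - F s \<and> F t - F s \<le> f s * (t - s)" if "0 \<le> s" "s \<le> t" for s t
  proof (cases "s = t")
    case False
    with that have "s < t" by simp
    moreover have "continuous_on {s..t} F"
      using cont by (rule continuous_on_subset) (use that in auto)
    moreover have "(F has_real_derivative f u) (at u)" if "s < u" "u < t" for u
      using deriv that \<open>0 \<le> s\<close> by simp
    ultimately obtain u where u: "s < u" "u < t" "F t - F s = (t - s) * f u"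
      using MVT[of s t F] by (metis DERIV_unique has_real_derivative real_differentiable_def)
    with anti[of s u] anti[of u t] that show ?thesis
      by (auto simp: mult.commute intro!: mult_right_mono)
  qed simp
  have F0: "F 0 = 0" by (simp add: F_def)
  \<comment> \<open>Right and left Riemann sums on [0, n]; as f 0 = 1, they differ by 1 - f n. The
    remaining piece [n, x] adds at most f n, which restores the error 1.\<close>
  have S: "(\<Sum>k=1..n. f (real k)) \<le> F (real n) \<and> F (real n) \<le> (\<Sum>k=1..n. f (real k)) + 1 - f (real n)" for n
  proof (induction n)
    case 0
    then show ?case by (simp add: F0) (simp add: f_def)
  next
    case (Suc n)
    with mvt[of "real n" "real (Suc n)"] show ?case by simp
  qed
  define n where "n = nat \<lfloor>x\<rfloor>"
  have n: "real n \<le> x" "x - real n \<le> 1" using x unfolding n_def by linarith+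
  have fx: "f x = 0" "f (real n) \<ge> 0"
    using anti[of "real n" x] n x by (auto simp: f_def)
  have "0 \<le> F x - F (real n)" "F x - F (real n) \<le> f (real n) * (x - real n)"
    using mvt[of "real n" x] n fx by auto
  moreover have "f (real n) * (x - real n) \<le> f (real n)"
    using fx n by (simp add: mult_left_le)
  moreover have "F x = x * \<alpha> / (\<alpha> + 1)" using x \<alpha> by (simp add: F_def field_simps)
  ultimately show ?thesis using S[of n] unfolding n_def f_def by auto
qed

definition zsum :: "nat \<Rightarrow> real" where "zsum n = (\<Sum>k=1..n. 1 / real k ^ 2)"

text \<open>The partial sums increase to the limit, while the partial sums plus 1 / n decrease to
  it, because 1 / (n + 1)^2 \<le> 1 / n - 1 / (n + 1).\<close>

lemma zsum_bounds:
  "zsum n \<le> pi\<^sup>2 / 6" "n > 0 \<Longrightarrow> zsum n \<ge> pi\<^sup>2 / 6 - 1 / real n"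
proof -
  have eq: "zsum = (\<lambda>n. \<Sum>k<n. 1 / (real k + 1) ^ 2)"
  proof
    show "zsum n = (\<Sum>k<n. 1 / (real k + 1) ^ 2)" for n
      unfolding zsum_def by (induction n) (auto simp: add_ac)
  qed
  have lim: "zsum \<longlonglongrightarrow> pi\<^sup>2 / 6"
    using inverse_squares_sums unfolding eq sums_def by (simp add: add_ac)
  have "incseq zsum" unfolding eq by (intro incseq_SucI) simp
  then show "zsum n \<le> pi\<^sup>2 / 6" using lim by (rule incseq_le)
  have "decseq (\<lambda>n. zsum (Suc n) + 1 / real (Suc n))"
  proof (intro decseq_SucI)
    fix n
    have "1 / real (Suc (Suc n)) ^ 2 \<le> 1 / (real (Suc n) * real (Suc (Suc n)))"
      unfolding power2_eq_square by (intro divide_left_mono mult_right_mono) auto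
    also have "\<dots> = 1 / real (Suc n) - 1 / real (Suc (Suc n))" by (simp add: field_simps)
    finally show "zsum (Suc (Suc n)) + 1 / real (Suc (Suc n)) \<le> zsum (Suc n) + 1 / real (Suc n)"
      by (simp add: zsum_def)
  qed
  moreover have "(\<lambda>n. zsum (Suc n) + 1 / real (Suc n)) \<longlonglongrightarrow> pi\<^sup>2 / 6 + 0"
    by (intro tendsto_add LIMSEQ_Suc[OF lim] LIMSEQ_Suc[OF lim_1_over_n])
  ultimately have "pi\<^sup>2 / 6 \<le> zsum (Suc m) + 1 / real (Suc m)" for m
    using decseq_ge by fastforce
  then show "n > 0 \<Longrightarrow> zsum n \<ge> pi\<^sup>2 / 6 - 1 / real n"
    by (cases n) (auto simp: algebra_simps)
qed

section \<open>Inverse squares summed over a square box\<close>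

text \<open>The derivative a / (a^2 + t^2) of arctan (t / a) decreases for t \<ge> 0, so its mean
  value on [b, b + 1] lies between the endpoint values.\<close>

lemma arctan_step:
  fixes a :: real
  assumes a: "a > 0" and b: "b \<ge> 0"
  shows "arctan ((b + 1) / a) - arctan (b / a) \<le> a / (a\<^sup>2 + b\<^sup>2)"
    and "a / (a\<^sup>2 + (b + 1)\<^sup>2) \<le> arctan ((b + 1) / a) - arctan (b / a)"
proof -
  have "\<exists>z>b. z < b + 1 \<and> arctan ((b + 1) / a) - arctan (b / a)
      = (b + 1 - b) * (inverse (1 + (z / a)\<^sup>2) * (1 / a))"
    using a by (intro MVT2) (auto intro!: derivative_eq_intros)
  then obtain z where z: "b < z" "z < b + 1"
    "arctan ((b + 1) / a) - arctan (b / a) = inverse (1 + (z / a)\<^sup>2) * (1 / a)" by auto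
  have eq: "inverse (1 + (z / a)\<^sup>2) * (1 / a) = a / (a\<^sup>2 + z\<^sup>2)"
    using a by (simp add: field_simps power2_eq_square add_pos_nonneg)
  have "b\<^sup>2 \<le> z\<^sup>2" "z\<^sup>2 \<le> (b + 1)\<^sup>2" using z b by (auto intro!: power_mono)
  then have "a / (a\<^sup>2 + z\<^sup>2) \<le> a / (a\<^sup>2 + b\<^sup>2)" "a / (a\<^sup>2 + (b + 1)\<^sup>2) \<le> a / (a\<^sup>2 + z\<^sup>2)"
    using a by (auto intro!: divide_left_mono mult_pos_pos add_pos_nonneg)
  then show "arctan ((b + 1) / a) - arctan (b / a) \<le> a / (a\<^sup>2 + b\<^sup>2)"
    "a / (a\<^sup>2 + (b + 1)\<^sup>2) \<le> arctan ((b + 1) / a) - arctan (b / a)"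
    unfolding z(3) eq by auto
qed

text \<open>The steps of \<open>arctan_step\<close> with a = n telescope to arctan 1 = pi / 4.
  Exchanging right for left endpoints costs g 0 - g n = 1 / (2 n); dividing by n gives the
  claim.\<close>

lemma sum_inverse_row:
  assumes "n > 0"
  defines "s \<equiv> (\<Sum>b=1..n. 1 / (real n ^ 2 + real b ^ 2))"
  shows "s \<le> pi / (4 * real n)" "pi / (4 * real n) - 1 / (2 * real n ^ 2) \<le> s"
proof -
  define g where "g b = real n / (real n ^ 2 + real b ^ 2)" for b
  have n: "real n > 0" using assms by simp
  have *: "(\<Sum>b=1..m. g b) \<le> arctan (real m / real n) \<and>
      arctan (real m / real n) \<le> (\<Sum>b=1..m. g b) + g 0 - g m" for m
  proof (induction m)
    case (Suc m)
    with arctan_step[OF n, of "real m"] show ?case by (simp add: g_def add_ac)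
  qed simp
  have "arctan (real n / real n) = pi / 4" using n by simp
  moreover have "g 0 - g n = 1 / (2 * real n)" using n by (simp add: g_def field_simps power2_eq_square)
  moreover have "(\<Sum>b=1..n. g b) = real n * s" by (simp add: g_def s_def sum_distrib_left)
  ultimately have "real n * s \<le> pi / 4" "pi / 4 \<le> real n * s + 1 / (2 * real n)"
    using *[of n] by auto
  then show "s \<le> pi / (4 * real n)" "pi / (4 * real n) - 1 / (2 * real n ^ 2) \<le> s"
    using n by (auto simp: field_simps power2_eq_square)
qed

text \<open>Induction on the side. The border added at side N is two copies of the row in
  \<open>sum_inverse_row\<close> sharing a corner; it contributes pi / (2 N), short by at most 3 /
  (2 N^2), which the increment 2 / N^2 of \<open>2 * zsum\<close> covers.\<close>

lemma sum_inverse_quadrant: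
  defines "D \<equiv> \<lambda>n. \<Sum>a=1..n. \<Sum>b=1..n. 1 / (real a ^ 2 + real b ^ 2)"
  shows "D n \<le> pi / 2 * harm n" "pi / 2 * harm n - 2 * zsum n \<le> D n"
proof -
  have "D n \<le> pi / 2 * harm n \<and> pi / 2 * harm n - 2 * zsum n \<le> D n"
  proof (induction n)
    case 0
    then show ?case by (simp add: D_def harm_def zsum_def)
  next
    case (Suc n)
    let ?N = "Suc n"
    define s where "s = (\<Sum>b=1..?N. 1 / (real ?N ^ 2 + real b ^ 2))"
    define t where "t = (\<Sum>b=1..n. 1 / (real ?N ^ 2 + real b ^ 2))"
    have st: "s = t + 1 / (2 * real ?N ^ 2)"
      by (simp add: s_def t_def)
    have "D ?N = D n + (\<Sum>a=1..n. 1 / (real a ^ 2 + real ?N ^ 2)) + s"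
      by (simp add: D_def s_def sum.distrib)
    also have "(\<Sum>a=1..n. 1 / (real a ^ 2 + real ?N ^ 2)) = t"
      by (simp add: t_def add_ac)
    finally have D: "D ?N = D n + 2 * s - 1 / (2 * real ?N ^ 2)" using st by simp
    have s: "s \<le> pi / (4 * real ?N)" "pi / (4 * real ?N) - 1 / (2 * real ?N ^ 2) \<le> s"
      using sum_inverse_row[of ?N] by (auto simp: s_def)
    have h: "pi / 2 * harm ?N = pi / 2 * harm n + 2 * (pi / (4 * real ?N))"
      by (simp add: harm_Suc field_simps)
    have z: "zsum ?N = zsum n + 2 * (1 / (2 * real ?N ^ 2))" by (simp add: zsum_def)
    have "0 \<le> 1 / (2 * real ?N ^ 2)" by simp
    moreover define q w where "q = 1 / (2 * real ?N ^ 2)" and "w = pi / (4 * real ?N)"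
    ultimately show ?case using conjunct1[OF Suc] conjunct2[OF Suc] s
      unfolding D h z q_def[symmetric] w_def[symmetric] by (simp add: algebra_simps)
  qed
  then show "D n \<le> pi / 2 * harm n" "pi / 2 * harm n - 2 * zsum n \<le> D n" by auto
qed

lemma sum_int_symmetric:
  fixes f :: "int \<Rightarrow> real"
  assumes "\<And>i. f (- i) = f i"
  shows "(\<Sum>i\<in>{-int n..int n}. f i) = f 0 + 2 * (\<Sum>k=1..n. f (int k))"
proof (induction n)
  case (Suc n)
  have "{-int (Suc n)..int (Suc n)} = insert (int (Suc n)) (insert (- int (Suc n)) {-int n..int n})"
    by auto
  then show ?case using Suc assms[of "int (Suc n)"] by simp
qed simp

lemma harm_ln_bounds:
  assumes "n > 0"
  shows "ln (real n) \<le> harm n" "harm n \<le> ln (real n) + (1::real)"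
proof -
  have "ln (real n) \<le> ln (real n + 1)" using assms by simp
  also have "\<dots> \<le> harm n" using ln_le_harm[of n] by simp
  finally show "ln (real n) \<le> harm n" .
  show "harm n \<le> ln (real n) + (1::real)" using euler_mascheroni_sequence_decreasing[of 1 n] assms by (simp add: harm_expand)
qed

text \<open>The origin contributes \<open>1 / 0 = 0\<close>.\<close>

lemma sum_inverse_box:
  assumes "n > 0"
  shows "\<bar>(\<Sum>(a, b)\<in>{-int n..int n} \<times> {-int n..int n}. 1 / (of_int a ^ 2 + of_int b ^ 2))
    - 2 * pi * ln (real n)\<bar> \<le> 16"
proof -
  define D where "D = (\<Sum>a=1..n. \<Sum>b=1..n. 1 / (real a ^ 2 + real b ^ 2))"
  have row: "(\<Sum>b\<in>{-int n..int n}. 1 / (of_int a ^ 2 + of_int b ^ 2)) =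
      1 / of_int a ^ 2 + 2 * (\<Sum>k=1..n. 1 / (of_int a ^ 2 + real k ^ 2))" for a :: int
    by (subst sum_int_symmetric) auto
  have "(\<Sum>(a, b)\<in>{-int n..int n} \<times> {-int n..int n}. 1 / (of_int a ^ 2 + of_int b ^ 2)) =
     (\<Sum>a\<in>{-int n..int n}. 1 / of_int a ^ 2 + 2 * (\<Sum>k=1..n. 1 / (of_int a ^ 2 + real k ^ 2)))"
    unfolding sum.cartesian_product[symmetric] row ..
  \<comment> \<open>The axes supply 4 zsum n, the four open quadrants 4 D.\<close>
  also have "\<dots> = 4 * zsum n + 4 * D"
    by (subst sum_int_symmetric) (auto simp: zsum_def D_def sum.distrib sum_distrib_left)
  finally have eq: "(\<Sum>(a, b)\<in>{-int n..int n} \<times> {-int n..int n}. 1 / (of_int a ^ 2 + of_int b ^ 2)) =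
     4 * zsum n + 4 * D" .
  have D: "D \<le> pi / 2 * harm n" "pi / 2 * harm n - 2 * zsum n \<le> D"
    unfolding D_def using sum_inverse_quadrant[of n] by auto
  have pi4: "pi < 4" using pi_less_4 .
  have "pi\<^sup>2 \<le> 3.15\<^sup>2" using pi_approx by (intro power_mono) auto
  then have z: "0 \<le> zsum n" "zsum n \<le> 2"
    using zsum_bounds(1)[of n] by (auto simp: zsum_def power2_eq_square intro!: sum_nonneg)
  define l h where "l = pi * ln (real n)" and "h = pi * harm n"
  have "l \<le> h"
    unfolding l_def h_def using harm_ln_bounds[OF assms] by (intro mult_left_mono) auto
  moreover have "h \<le> pi * (ln (real n) + 1)"
    unfolding h_def using harm_ln_bounds[OF assms] by (intro mult_left_mono) auto
  then have "h \<le> l + pi" by (simp add: l_def distrib_left)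
  moreover have "D \<le> h / 2" "h / 2 - 2 * zsum n \<le> D" using D by (auto simp: h_def)
  moreover have "2 * pi * ln (real n) = 2 * l" by (simp add: l_def)
  \<comment> \<open>The sum is within 4 zsum n \<le> 8 of 2 h, and 2 h exceeds 2 l by at most 2 pi <
    8.\<close>
  ultimately show ?thesis using z pi4 unfolding eq by linarith
qed

section \<open>Lattice vectors in a disc\<close>

definition sqn :: "int \<times> int \<Rightarrow> int" where
  "sqn v = fst v ^ 2 + snd v ^ 2"

definition len :: "int \<times> int \<Rightarrow> real" where
  "len v = sqrt (of_int (sqn v))"

definition lat :: "real \<Rightarrow> (int \<times> int) set" where
  "lat X = {v. v \<noteq> (0, 0) \<and> len v \<le> X}"

text \<open>Coprimality excludes the origin, since gcd 0 0 = 0; both v and - v are kept.\<close>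

definition prim :: "real \<Rightarrow> (int \<times> int) set" where
  "prim X = {v. coprime (fst v) (snd v) \<and> len v \<le> X}"

definition invsq_sum :: "(int \<times> int) set \<Rightarrow> real" where
  "invsq_sum A = (\<Sum>v\<in>A. 1 / len v ^ 2)"

lemma len_sq: "len v ^ 2 = of_int (sqn v)"
  by (simp add: len_def sqn_def)

lemma len_nonneg [simp]: "len v \<ge> 0"
  by (simp add: len_def sqn_def)

lemma len_pos: "v \<noteq> (0, 0) \<Longrightarrow> len v > 0"
  by (cases v) (auto simp: len_def sqn_def add_pos_nonneg add_nonneg_pos)

lemma len_ge_1:
  assumes "v \<noteq> (0, 0)" shows "len v \<ge> 1"
proof -
  have "sqn v > 0" using len_pos[OF assms] by (simp add: len_def)
  then have "of_int (sqn v) \<ge> (1::real)" by linarith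
  then show ?thesis by (simp add: len_def)
qed

lemma abs_le_len: "\<bar>of_int (fst v)\<bar> \<le> len v" "\<bar>of_int (snd v)\<bar> \<le> len v"
  by (auto simp: len_def sqn_def intro!: real_le_rsqrt)

lemma len_scale: "len (k * fst v, k * snd v) = \<bar>of_int k\<bar> * len v"
proof -
  have "of_int (sqn (k * fst v, k * snd v)) = (of_int k)\<^sup>2 * (of_int (sqn v) :: real)"
    by (simp add: sqn_def algebra_simps)
  then show ?thesis by (simp add: len_def real_sqrt_mult)
qed

lemma lat_subset_box:
  "lat X \<subseteq> {-int (nat \<lfloor>X\<rfloor>)..int (nat \<lfloor>X\<rfloor>)} \<times> {-int (nat \<lfloor>X\<rfloor>)..int (nat \<lfloor>X\<rfloor>)}"
proof
  fix v assume "v \<in> lat X"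
  then have "len v \<le> X" by (simp add: lat_def)
  with abs_le_len[of v] have "\<bar>of_int (fst v)\<bar> \<le> X" "\<bar>of_int (snd v)\<bar> \<le> X" by linarith+
  then have "\<bar>fst v\<bar> \<le> int (nat \<lfloor>X\<rfloor>)" "\<bar>snd v\<bar> \<le> int (nat \<lfloor>X\<rfloor>)" by linarith+
  then show "v \<in> {-int (nat \<lfloor>X\<rfloor>)..int (nat \<lfloor>X\<rfloor>)} \<times> {-int (nat \<lfloor>X\<rfloor>)..int (nat \<lfloor>X\<rfloor>)}"
    by (cases v) auto
qed

lemma finite_lat [simp]: "finite (lat X)"
  using lat_subset_box by (rule finite_subset) auto

lemma prim_subset_lat: "prim X \<subseteq> lat X"
  by (auto simp: prim_def lat_def)

lemma finite_prim [simp]: "finite (prim X)"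
  using prim_subset_lat finite_lat by (rule finite_subset)

lemma prim_mono: "X \<le> Y \<Longrightarrow> prim X \<subseteq> prim Y"
  by (auto simp: prim_def)

lemma invsq_sum_mono: "finite B \<Longrightarrow> A \<subseteq> B \<Longrightarrow> invsq_sum A \<le> invsq_sum B"
  unfolding invsq_sum_def by (rule sum_mono2) auto

lemma card_lat_le:
  assumes "X \<ge> 1" shows "real (card (lat X)) \<le> 9 * X\<^sup>2"
proof -
  define n where "n = nat \<lfloor>X\<rfloor>"
  have n: "real n \<le> X" using assms unfolding n_def by linarith
  have "card (lat X) \<le> card ({-int n..int n} \<times> {-int n..int n})"
    unfolding n_def by (intro card_mono lat_subset_box) auto
  also have "\<dots> = (2 * n + 1)\<^sup>2"
  proof -
    have "card {-int n..int n} = 2 * n + 1" by simp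
    then show ?thesis by (simp add: card_cartesian_product power2_eq_square)
  qed
  finally have "real (card (lat X)) \<le> (2 * real n + 1)\<^sup>2"
    by (metis (mono_tags, lifting) of_nat_1 of_nat_add of_nat_le_iff of_nat_mult of_nat_numeral of_nat_power)
  also have "\<dots> \<le> (3 * X)\<^sup>2" using n assms by (intro power_mono) auto
  finally show ?thesis by (simp add: power_mult_distrib)
qed

text \<open>Up to the origin, the disc lies between the boxes with n = floor (X / 2) and n = floor
  X. Changing the cutoff by a bounded factor moves the logarithm by O(1).\<close>

lemma invsq_sum_lat:
  assumes X: "X \<ge> 1"
  shows "\<bar>invsq_sum (lat X) - 2 * pi * ln X\<bar> \<le> 32"
proof -
  define box where "box n = {-int n..int n} \<times> {-int n..int n}" for n
  have box: "\<bar>invsq_sum (box n) - 2 * pi * ln (real n)\<bar> \<le> 16" if "n > 0" for n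
    using sum_inverse_box[OF that]
    by (simp add: invsq_sum_def box_def len_sq sqn_def case_prod_beta)
  have up: "invsq_sum (lat X) \<le> 2 * pi * ln X + 32"
  proof -
    define n where "n = nat \<lfloor>X\<rfloor>"
    have n: "n > 0" "real n \<le> X" using X unfolding n_def by linarith+
    have "invsq_sum (lat X) \<le> invsq_sum (box n)"
      unfolding box_def n_def by (intro invsq_sum_mono lat_subset_box) auto
    moreover have "2 * pi * ln (real n) \<le> 2 * pi * ln X" using n by simp
    ultimately show ?thesis using box[OF n(1)] by linarith
  qed
  have ln2: "ln (2::real) < 1" using ln_2_less_1 .
  have low: "2 * pi * ln X - 32 \<le> invsq_sum (lat X)"
  proof (cases "X \<ge> 2")
    case True
    define n where "n = nat \<lfloor>X / 2\<rfloor>"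
    have n: "n > 0" "real n \<le> X / 2" and "real n > X / 2 - 1"
      using True unfolding n_def by linarith+
    \<comment> \<open>From n \<ge> 1 follows 2 n \<ge> n + 1 > X / 2.\<close>
    then have n4: "X / 4 \<le> real n" by (simp add: field_simps)
    have "invsq_sum (box n) = invsq_sum (box n - {(0, 0)})"
      unfolding invsq_sum_def by (rule sum.mono_neutral_right) (auto simp: box_def len_def sqn_def)
    also have "\<dots> \<le> invsq_sum (lat X)"
    proof (intro invsq_sum_mono subsetI)
      fix v assume v: "v \<in> box n - {(0, 0)}"
      then have "\<bar>fst v\<bar> \<le> int n" "\<bar>snd v\<bar> \<le> int n" by (auto simp: box_def)
      then have "fst v ^ 2 \<le> int n ^ 2" "snd v ^ 2 \<le> int n ^ 2"
        by (metis abs_le_square_iff abs_of_nat)+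
      then have "sqn v \<le> 2 * int n ^ 2" by (simp add: sqn_def)
      then have "real_of_int (sqn v) \<le> real_of_int (2 * int n ^ 2)" by (rule of_int_le_iff[THEN iffD2])
      also have "\<dots> \<le> (2 * real n)\<^sup>2" by (simp add: power_mult_distrib)
      finally have "len v \<le> 2 * real n" unfolding len_def by (rule real_le_lsqrt[rotated 1]) auto
      with n v show "v \<in> lat X" by (auto simp: lat_def)
    qed auto
    finally have "invsq_sum (box n) \<le> invsq_sum (lat X)" .
    moreover have "ln (X / 4) \<le> ln (real n)" using n n4 True by simp
    then have "ln X - 2 * ln 2 \<le> ln (real n)"
      using True ln_realpow[of 2 2] by (simp add: ln_div)
    with ln2 have "ln X - 2 \<le> ln (real n)" by linarith
    then have "2 * pi * (ln X - 2) \<le> 2 * pi * ln (real n)" by (intro mult_left_mono) auto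
    then have "2 * pi * ln X - 4 * pi \<le> 2 * pi * ln (real n)" by (simp add: algebra_simps)
    ultimately show ?thesis using box[OF n(1)] pi_less_4 by linarith
  next
    case False
    then have "ln X \<le> ln 2" using X by simp
    then have "2 * pi * ln X \<le> 2 * pi * 1" using ln2 by (intro mult_left_mono) auto
    moreover have "0 \<le> invsq_sum (lat X)" unfolding invsq_sum_def by (intro sum_nonneg) auto
    ultimately show ?thesis using pi_less_4 by linarith
  qed
  show ?thesis using up low by linarith
qed

section \<open>Primitive vectors and comparison of cutoffs\<close>

lemma primitive_decomposition:
  assumes "v \<noteq> (0, 0)"
  obtains k w where "k > 0" "coprime (fst w) (snd w)" "v = (int k * fst w, int k * snd w)"
proof -
  obtain a b where v: "v = (a, b)" by (cases v)
  define g where "g = gcd a b"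
  have g: "g > 0" using assms v by (auto simp: g_def)
  show ?thesis
  proof (rule that[of "nat g" "(a div g, b div g)"])
    show "coprime (fst (a div g, b div g)) (snd (a div g, b div g))"
      using assms v by (auto simp: g_def intro!: div_gcd_coprime)
  qed (use g v in \<open>auto simp: g_def\<close>)
qed

lemma primitive_decomposition_unique:
  assumes "int k * a = int k' * a'" "int k * b = int k' * b'" "k > 0" "k' > 0"
    "coprime a b" "coprime a' b'"
  shows "k = k'" "a = a'" "b = b'"
proof -
  have "gcd (int k * a) (int k * b) = int k" "gcd (int k' * a') (int k' * b') = int k'"
    using assms(5,6) by (simp_all add: gcd_mult_distrib_int[symmetric])
  then show "k = k'" using assms(1,2) by simp
  then show "a = a'" "b = b'" using assms by auto
qed

lemma invsq_sum_scale:
  "(\<Sum>(v, k)\<in>A \<times> {1..n}. 1 / len (int k * fst v, int k * snd v) ^ 2) = invsq_sum A * zsum n"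
  unfolding invsq_sum_def zsum_def sum_product sum.cartesian_product
  by (simp add: len_scale power_mult_distrib mult.commute)

text \<open>Each vector of the disc is k w with w primitive in the same disc and k \<le> X; the
  factors 1 / k^2 sum to at most zeta(2).\<close>

lemma invsq_sum_lat_le_prim: "invsq_sum (lat X) \<le> pi\<^sup>2 / 6 * invsq_sum (prim X)"
proof -
  define n where "n = nat \<lfloor>X\<rfloor>"
  define f where "f = (\<lambda>(v :: int \<times> int, k). (int k * fst v, int k * snd v))"
  have "lat X \<subseteq> f ` (prim X \<times> {1..n})"
  proof
    fix v assume v: "v \<in> lat X"
    then obtain k w where kw: "k > 0" "coprime (fst w) (snd w)" "v = (int k * fst w, int k * snd w)"
      by (metis (mono_tags, lifting) lat_def mem_Collect_eq primitive_decomposition)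
    have "w \<noteq> (0, 0)" using kw by auto
    then have w1: "len w \<ge> 1" by (rule len_ge_1)
    have kX: "real k * len w \<le> X" using v kw(3) by (simp add: lat_def len_scale)
    have "len w \<le> real k * len w" "real k \<le> real k * len w"
      using kw(1) w1 by (auto simp: mult_le_cancel_right1 mult_le_cancel_left1)
    with kX have "len w \<le> X" "real k \<le> X" by linarith+
    moreover from this(2) have "k \<le> n" unfolding n_def by linarith
    ultimately show "v \<in> f ` (prim X \<times> {1..n})" using kw
      by (intro image_eqI[of _ _ "(w, k)"]) (auto simp: f_def prim_def)
  qed
  then have "invsq_sum (lat X) \<le> invsq_sum (f ` (prim X \<times> {1..n}))"
    by (intro invsq_sum_mono) auto
  also have "\<dots> \<le> (\<Sum>p\<in>prim X \<times> {1..n}. 1 / len (f p) ^ 2)"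
    unfolding invsq_sum_def by (rule order.trans[OF sum_image_le]) (auto simp: o_def)
  also have "\<dots> = invsq_sum (prim X) * zsum n"
    unfolding invsq_sum_scale[symmetric] by (intro sum.cong) (auto simp: f_def)
  also have "\<dots> \<le> invsq_sum (prim X) * (pi\<^sup>2 / 6)"
    by (intro mult_left_mono zsum_bounds) (auto simp: invsq_sum_def intro!: sum_nonneg)
  finally show ?thesis by (simp add: mult.commute)
qed

text \<open>The multiples k v with k \<le> K are pairwise distinct, by uniqueness of the
  decomposition, and stay within radius K X.\<close>

lemma invsq_sum_prim_le_lat: "zsum K * invsq_sum (prim X) \<le> invsq_sum (lat (real K * X))"
proof -
  define f where "f = (\<lambda>(v :: int \<times> int, k). (int k * fst v, int k * snd v))"
  have inj: "inj_on f (prim X \<times> {1..K})"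
    by (rule inj_onI) (auto simp: f_def prim_def prod_eq_iff Suc_le_eq dest: primitive_decomposition_unique)
  have sub: "f ` (prim X \<times> {1..K}) \<subseteq> lat (real K * X)"
  proof (rule image_subsetI)
    fix p assume "p \<in> prim X \<times> {1..K}"
    then obtain a b k where p: "p = ((a, b), k)" and "(a, b) \<in> prim X" "k \<in> {1..K}"
      by (metis SigmaE surj_pair)
    then have *: "coprime a b" "len (a, b) \<le> X" "k > 0" "k \<le> K" by (auto simp: prim_def)
    have "len (f ((a, b), k)) = real k * len (a, b)"
      using len_scale[of "int k" "(a, b)"] by (simp add: f_def)
    also have "\<dots> \<le> real K * X" using * by (intro mult_mono) auto
    finally show "f p \<in> lat (real K * X)" using * p by (auto simp: lat_def f_def)
  qed
  have "zsum K * invsq_sum (prim X) = (\<Sum>p\<in>prim X \<times> {1..K}. 1 / len (f p) ^ 2)"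
    unfolding mult.commute[of "zsum K"] invsq_sum_scale[symmetric]
    by (intro sum.cong) (auto simp: f_def)
  also have "\<dots> = invsq_sum (f ` (prim X \<times> {1..K}))"
    unfolding invsq_sum_def by (subst sum.reindex[OF inj]) (simp add: o_def)
  also have "\<dots> \<le> invsq_sum (lat (real K * X))" using sub by (intro invsq_sum_mono) auto
  finally show ?thesis .
qed

lemma invsq_sum_nonneg: "invsq_sum A \<ge> 0"
  unfolding invsq_sum_def by (intro sum_nonneg) auto

lemma ln_ge_1_imp_gt_1:
  assumes "ln X \<ge> 1" "X > 0" shows "X > (1::real)"
  using assms by (metis ln_gt_zero_iff less_le_trans zero_less_one)

lemma sqrt_le_self:
  assumes "y \<ge> (1::real)" shows "sqrt y \<le> y"
  using assms by (intro real_le_lsqrt) (auto intro: self_le_power)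

text \<open>The lower bound is \<open>invsq_sum_lat_le_prim\<close>. In the upper bound,
  \<open>invsq_sum_prim_le_lat\<close> loses 2 pi ln K by the larger cutoff and at most P / K by
  replacing \<open>zsum K\<close> with zeta(2); K near sqrt (ln X) keeps both within O(sqrt (ln
  X)).\<close>

lemma invsq_sum_prim_asymp:
  assumes X: "X > 0" "ln X \<ge> 1"
  shows "\<bar>invsq_sum (prim X) - 12 / pi * ln X\<bar> \<le> 80 * sqrt (ln X)"
proof -
  define P where "P = invsq_sum (prim X)"
  define z where "z = pi\<^sup>2 / 6"
  define s where "s = sqrt (ln X)"
  define K where "K = nat \<lceil>s\<rceil>"
  have X1: "X > 1" using X by (rule ln_ge_1_imp_gt_1[rotated])
  have s: "s \<ge> 1" "ln X = s * s" "s \<le> ln X"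
    using X by (auto simp: s_def intro: sqrt_le_self)
  have K: "K > 0" "s \<le> real K" "real K \<le> s + 1" using s unfolding K_def by linarith+
  have "3\<^sup>2 \<le> pi\<^sup>2" using pi_gt3 by (intro power_mono) auto
  then have z: "z \<ge> 1" by (simp add: z_def)
  have zl: "z * (12 / pi * ln X) = 2 * pi * ln X" by (simp add: z_def power2_eq_square)
  have P0: "P \<ge> 0" by (simp add: P_def invsq_sum_nonneg)
  have low: "P \<ge> 12 / pi * ln X - 80 * s"
  proof (rule ccontr)
    assume "\<not> ?thesis"
    then have "z * P < z * (12 / pi * ln X - 80 * s)" using z by (intro mult_strict_left_mono) auto
    also have "\<dots> = 2 * pi * ln X - z * (80 * s)" unfolding zl[symmetric] by (rule right_diff_distrib)
    also have "\<dots> \<le> 2 * pi * ln X - 80 * s"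
      using mult_right_mono[OF z, of "80 * s"] s by simp
    finally have "z * P < 2 * pi * ln X - 80 * s" .
    moreover have "2 * pi * ln X - 32 \<le> z * P"
      using invsq_sum_lat[of X] invsq_sum_lat_le_prim[of X] X1 unfolding z_def P_def by linarith
    ultimately show False using s by linarith
  qed
  have up: "P \<le> 12 / pi * ln X + 80 * s"
  proof -
    \<comment> \<open>A crude bound P = O(ln X) comes first, because the loss P / K depends on P
      itself.\<close>
    have "P \<le> invsq_sum (lat X)" unfolding P_def by (intro invsq_sum_mono prim_subset_lat) auto
    also have "\<dots> \<le> 2 * pi * ln X + 32" using invsq_sum_lat[of X] X1 by linarith
    also have "2 * pi * ln X \<le> 2 * 4 * ln X"
      using pi_less_4 X1 by (intro mult_right_mono) auto
    finally have P40: "P \<le> 40 * ln X" using X by simp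
    have "1 \<le> real K * X" using K(1) X1 by (metis less_imp_le mult_le_cancel_right1 mult_mono
      nat_less_real_le of_nat_0 of_nat_0_le_iff add_0 mult_1 zero_le_one)
    then have "invsq_sum (lat (real K * X)) \<le> 2 * pi * ln (real K * X) + 32"
      using invsq_sum_lat[of "real K * X"] by linarith
    also have "2 * pi * ln (real K * X) = 2 * pi * ln X + 2 * pi * ln (real K)"
      using K X1 by (simp add: ln_mult algebra_simps)
    \<comment> \<open>ln K \<le> K - 1 \<le> s yields 8 s; with 32 \<le> 32 s the total is 40
      s.\<close>
    also have "2 * pi * ln (real K) \<le> 2 * 4 * s"
      using K ln_le_minus_one[of "real K"] pi_less_4 s by (intro mult_mono) auto
    finally have 1: "zsum K * P \<le> 2 * pi * ln X + 40 * s"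
      using invsq_sum_prim_le_lat[of K X] s unfolding P_def by linarith
    have "z * P \<le> (zsum K + 1 / real K) * P"
      using zsum_bounds(2)[OF K(1)] P0 unfolding z_def by (intro mult_right_mono) linarith+
    also have "\<dots> = zsum K * P + P / real K" by (simp add: algebra_simps)
    also have "P / real K \<le> 40 * ln X / s"
      using P40 K s X by (intro frac_le) auto
    also have "40 * ln X / s = 40 * s" using s by simp
    finally have "z * P \<le> z * (12 / pi * ln X) + 80 * s" using 1 unfolding zl by linarith
    also have "\<dots> \<le> z * (12 / pi * ln X) + z * (80 * s)"
      using mult_right_mono[OF z, of "80 * s"] s by simp
    also have "\<dots> = z * (12 / pi * ln X + 80 * s)" by (simp add: algebra_simps)
    finally show ?thesis using z by simp
  qed
  show ?thesis using low up unfolding P_def s_def by linarith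
qed

section \<open>Parity weights and multiplication by 1 + i\<close>

text \<open>Share of the multiples k that occur in the direction of a primitive v: all k if both
  coordinates are odd, only even k otherwise.\<close>

definition weight :: "int \<times> int \<Rightarrow> real" where
  "weight v = (if even (fst v + snd v) then 1 else 1 / 2)"

definition weighted_sum :: "real \<Rightarrow> real" where
  "weighted_sum X = (\<Sum>v\<in>prim X. weight v / len v ^ 2)"

definition prim_odd :: "real \<Rightarrow> (int \<times> int) set" where
  "prim_odd X = {v \<in> prim X. odd (fst v + snd v)}"

definition prim_even :: "real \<Rightarrow> (int \<times> int) set" where
  "prim_even X = {v \<in> prim X. even (fst v + snd v)}"

text \<open>Multiplication by \<open>1 + i\<close> on Gaussian integers.\<close>

definition rot :: "int \<times> int \<Rightarrow> int \<times> int" where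
  "rot v = (fst v - snd v, fst v + snd v)"

lemma len_rot: "len (rot v) = sqrt 2 * len v"
proof -
  have "of_int (sqn (rot v)) = 2 * (of_int (sqn v) :: real)"
    by (simp add: sqn_def rot_def algebra_simps power2_eq_square)
  then show ?thesis by (simp add: len_def real_sqrt_mult)
qed

text \<open>A common divisor of a - b and a + b divides 2 a and 2 b, and is odd because it divides
  the odd number a + b.\<close>

lemma coprime_rot:
  assumes "odd (a + b)" shows "coprime (a - b) (a + b) \<longleftrightarrow> coprime a (b :: int)"
proof
  assume c: "coprime (a - b) (a + b)"
  show "coprime a b"
  proof (rule coprimeI)
    fix d assume "d dvd a" "d dvd b"
    then have "d dvd a - b" "d dvd a + b" by auto
    with c show "is_unit d" by (rule coprime_common_divisor)
  qed
next
  assume c: "coprime a b"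
  show "coprime (a - b) (a + b)"
  proof (rule coprimeI)
    fix d assume d: "d dvd a - b" "d dvd a + b"
    then have "odd d" using assms by (meson dvd_trans)
    then have cop: "coprime d 2" by simp
    have "d dvd (a - b) + (a + b)" "d dvd (a + b) - (a - b)" using d by (blast intro: dvd_add dvd_diff)+
    then have "d dvd 2 * a" "d dvd 2 * b" by (simp_all add: algebra_simps)
    with cop have "d dvd a" "d dvd b" by (simp_all add: coprime_dvd_mult_right_iff)
    with c show "is_unit d" by (rule coprime_common_divisor)
  qed
qed

text \<open>A primitive (c, d) with even coordinate sum has odd coordinates, so it is divisible by 1
  + i; the quotient ((c + d) / 2, (d - c) / 2) has the odd coordinate sum d.\<close>

lemma bij_betw_rot: "bij_betw rot (prim_odd (X / sqrt 2)) (prim_even X)"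
  unfolding bij_betw_def
proof
  show "inj_on rot (prim_odd (X / sqrt 2))" by (rule inj_onI) (auto simp: rot_def prod_eq_iff)
  show "rot ` prim_odd (X / sqrt 2) = prim_even X"
  proof (intro subset_antisym subsetI)
    fix w assume "w \<in> rot ` prim_odd (X / sqrt 2)"
    then obtain v where v: "w = rot v" "v \<in> prim_odd (X / sqrt 2)" by auto
    then have "len w \<le> X" by (simp add: prim_odd_def prim_def len_rot field_simps)
    moreover have "coprime (fst w) (snd w)"
      using v coprime_rot[of "fst v" "snd v"] by (simp add: prim_odd_def prim_def rot_def)
    ultimately show "w \<in> prim_even X" using v by (simp add: prim_even_def prim_def rot_def)
  next
    fix w assume w: "w \<in> prim_even X"
    obtain c d where cd: "w = (c, d)" by (cases w)
    with w have "coprime c d" "even (c + d)" "len w \<le> X" by (auto simp: prim_even_def prim_def)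
    then have odd: "odd c" "odd d" by (auto simp: coprime_common_divisor_int intro: ccontr)
    define a b where "a = (c + d) div 2" and "b = (d - c) div 2"
    have ab: "c = a - b" "d = a + b" using odd \<open>even (c + d)\<close> unfolding a_def b_def by presburger+
    then have wr: "w = rot (a, b)" using cd by (simp add: rot_def)
    have o: "odd (a + b)" using odd ab by simp
    moreover have "coprime a b" using coprime_rot[OF o] \<open>coprime c d\<close> ab by simp
    moreover have "len (a, b) \<le> X / sqrt 2"
      using \<open>len w \<le> X\<close> unfolding wr len_rot by (simp add: field_simps)
    ultimately show "w \<in> rot ` prim_odd (X / sqrt 2)"
      unfolding wr by (intro imageI) (auto simp: prim_odd_def prim_def)
  qed
qed

lemma invsq_sum_prim_even: "invsq_sum (prim_even X) = invsq_sum (prim_odd (X / sqrt 2)) / 2"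
  unfolding invsq_sum_def sum.reindex_bij_betw[OF bij_betw_rot, symmetric]
  by (simp add: len_rot power_mult_distrib sum_divide_distrib mult.commute)

lemma finite_prim_parity [simp]: "finite (prim_odd X)" "finite (prim_even X)"
  by (auto simp: prim_odd_def prim_even_def)

lemma prim_parity_split: "prim X = prim_odd X \<union> prim_even X" "prim_odd X \<inter> prim_even X = {}"
  by (auto simp: prim_odd_def prim_even_def)

text \<open>With M the sum over the odd class, \<open>bij_betw_rot\<close> makes the full sum at Y
  equal to M Y + M (Y / sqrt 2) / 2 and the weighted sum equal to M X / 2 + M (X / sqrt 2) / 2.
  Monotonicity of M compares the two, without asymptotics for M.\<close>

lemma weighted_sum_bounds:
  assumes "X \<ge> 0"
  shows "weighted_sum X \<le> 2 / 3 * invsq_sum (prim X)"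
    and "2 / 3 * invsq_sum (prim (X / 2)) \<le> weighted_sum X"
proof -
  define M where "M Y = invsq_sum (prim_odd Y)" for Y
  have P: "invsq_sum (prim Y) = M Y + M (Y / sqrt 2) / 2" for Y
    unfolding M_def invsq_sum_prim_even[symmetric] unfolding invsq_sum_def
    by (subst prim_parity_split(1), subst sum.union_disjoint) (auto simp: prim_parity_split)
  have M_mono: "M Y \<le> M Z" if "Y \<le> Z" for Y Z
    unfolding M_def using prim_mono[OF that] by (intro invsq_sum_mono) (auto simp: prim_odd_def)
  have "weighted_sum X = (\<Sum>v\<in>prim_odd X. weight v / len v ^ 2) + (\<Sum>v\<in>prim_even X. weight v / len v ^ 2)"
    unfolding weighted_sum_def
    by (subst prim_parity_split(1), subst sum.union_disjoint) (auto simp: prim_parity_split)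
  also have "(\<Sum>v\<in>prim_odd X. weight v / len v ^ 2) = M X / 2"
    unfolding M_def invsq_sum_def sum_divide_distrib
    by (intro sum.cong) (auto simp: prim_odd_def weight_def)
  also have "(\<Sum>v\<in>prim_even X. weight v / len v ^ 2) = invsq_sum (prim_even X)"
    unfolding invsq_sum_def by (intro sum.cong) (auto simp: prim_even_def weight_def)
  also have "\<dots> = M (X / sqrt 2) / 2" unfolding M_def by (rule invsq_sum_prim_even)
  finally have W: "weighted_sum X = M X / 2 + M (X / sqrt 2) / 2" .
  have "sqrt 2 \<ge> 1" "sqrt 2 \<le> 2" by (auto intro: real_le_lsqrt)
  then have le: "X / sqrt 2 \<le> X" "X / 2 \<le> X / sqrt 2" "X / 2 / sqrt 2 \<le> X / sqrt 2"
    using assms by (auto simp: field_simps mult_le_cancel_left1 intro: mult_left_mono)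
  show "weighted_sum X \<le> 2 / 3 * invsq_sum (prim X)"
    using M_mono[OF le(1)] unfolding W P by simp
  show "2 / 3 * invsq_sum (prim (X / 2)) \<le> weighted_sum X"
    using M_mono[OF le(1)] M_mono[OF le(2)] M_mono[OF le(3)] unfolding W P by simp
qed

lemma weighted_sum_asymp:
  assumes X: "X > 0" "ln X \<ge> 2"
  shows "\<bar>weighted_sum X - 8 / pi * ln X\<bar> \<le> 60 * sqrt (ln X)"
proof -
  have s: "sqrt (ln X) \<ge> 1" using X by simp
  have l2: "ln (X / 2) = ln X - ln 2" using X by (simp add: ln_div)
  have lg: "ln (X / 2) \<ge> 1" using l2 ln_2_less_1 X by linarith
  define A B where "A = 12 / pi * ln X" and "B = 12 / pi * ln (X / 2)"
  have A: "8 / pi * ln X = 2 / 3 * A" by (simp add: A_def)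
  have up: "weighted_sum X \<le> 2 / 3 * (A + 80 * sqrt (ln X))"
    using weighted_sum_bounds(1)[of X] invsq_sum_prim_asymp[of X] X
    unfolding A_def[symmetric] by (simp add: abs_le_iff)
  have "sqrt (ln (X / 2)) \<le> sqrt (ln X)" using X by simp
  moreover have "\<bar>invsq_sum (prim (X / 2)) - B\<bar> \<le> 80 * sqrt (ln (X / 2))"
    unfolding B_def using X lg by (intro invsq_sum_prim_asymp) auto
  ultimately have "B - 80 * sqrt (ln X) \<le> invsq_sum (prim (X / 2))" by linarith
  then have low: "2 / 3 * (B - 80 * sqrt (ln X)) \<le> weighted_sum X"
    using weighted_sum_bounds(2)[of X] X by simp
  \<comment> \<open>Halving the cutoff costs at most 4, and 2 / 3 of 80 t + 4 is at most 60 t for t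
    \<ge> 1.\<close>
  have "12 / pi * ln 2 \<le> 12 / 3 * 1"
    using pi_gt3 ln_2_less_1 by (intro mult_mono divide_left_mono) auto
  then have "A \<le> B + 4" unfolding A_def B_def l2 right_diff_distrib by simp
  moreover define t where "t = sqrt (ln X)"
  ultimately show ?thesis using up low s unfolding A t_def[symmetric] by (simp add: abs_le_iff)
qed

text \<open>Cauchy-Schwarz against the constant 1, over at most 9 X^2 vectors. The factor sqrt (ln
  X) is affordable: relative to X ln X it leaves 1 / sqrt (ln X).\<close>

lemma sum_inverse_len_prim:
  assumes X: "X > 0" "ln X \<ge> 1"
  shows "(\<Sum>v\<in>prim X. 1 / len v) \<le> 30 * X * sqrt (ln X)"
    and "invsq_sum (prim X) \<le> 100 * ln X"
proof -
  have X1: "X > 1" using X by (rule ln_ge_1_imp_gt_1[rotated])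
  have "sqrt (ln X) \<le> ln X" using X by (intro sqrt_le_self)
  moreover have "12 / pi * ln X \<le> 12 / 3 * ln X"
    using pi_gt3 X X1 by (intro mult_right_mono divide_left_mono) auto
  ultimately show 100: "invsq_sum (prim X) \<le> 100 * ln X"
    using invsq_sum_prim_asymp[OF X] by linarith
  have "(\<Sum>v\<in>prim X. 1 * (1 / len v))\<^sup>2 \<le> (\<Sum>v\<in>prim X. 1\<^sup>2) * (\<Sum>v\<in>prim X. (1 / len v)\<^sup>2)"
    by (rule Cauchy_Schwarz_ineq_sum)
  also have "\<dots> = real (card (prim X)) * invsq_sum (prim X)"
    by (simp add: invsq_sum_def power_one_over)
  also have "\<dots> \<le> (9 * X\<^sup>2) * (100 * ln X)"
  proof (intro mult_mono 100 invsq_sum_nonneg)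
    have "card (prim X) \<le> card (lat X)" by (intro card_mono prim_subset_lat) auto
    with card_lat_le[of X] X1 show "real (card (prim X)) \<le> 9 * X\<^sup>2" by linarith
  qed auto
  also have "\<dots> = (30 * X * sqrt (ln X))\<^sup>2" using X X1 by (simp add: power_mult_distrib)
  finally have "(\<Sum>v\<in>prim X. 1 / len v)\<^sup>2 \<le> (30 * X * sqrt (ln X))\<^sup>2" by simp
  moreover have "0 \<le> 30 * X * sqrt (ln X)" using X X1 by simp
  ultimately show "(\<Sum>v\<in>prim X. 1 / len v) \<le> 30 * X * sqrt (ln X)"
    by (rule power2_le_imp_le)
qed

section \<open>Integers of one parity class on a line through an annulus\<close>

lemma parity_class_eq_image:
  fixes r :: int
  assumes "\<And>j. P (2 * j + r) \<longleftrightarrow> j \<in> J"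
  shows "{l. even (l - r) \<and> P l} = (\<lambda>j. 2 * j + r) ` J"
proof (intro set_eqI iffI)
  fix l assume l: "l \<in> {l. even (l - r) \<and> P l}"
  then obtain j where "l = 2 * j + r"
    by (metis (no_types, lifting) dvdE diff_add_cancel mem_Collect_eq)
  with l assms[of j] show "l \<in> (\<lambda>j. 2 * j + r) ` J" by blast
next
  fix l assume "l \<in> (\<lambda>j. 2 * j + r) ` J"
  then obtain j where "l = 2 * j + r" "j \<in> J" by blast
  with assms[of j] show "l \<in> {l. even (l - r) \<and> P l}" by simp
qed

text \<open>Substituting l = 2 j + r turns [- L, L] into an interval of length L for j.\<close>

lemma card_parity_class_closed:
  fixes L :: real and r :: int
  assumes L: "L \<ge> 0"
  shows "\<bar>real (card {l. even (l - r) \<and> \<bar>of_int l\<bar> \<le> L}) - L\<bar> \<le> 1"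
    and "finite {l. even (l - r) \<and> \<bar>of_int l\<bar> \<le> L}"
proof -
  define x y where "x = (- L - of_int r) / 2" and "y = (L - of_int r) / 2"
  have iff: "\<bar>of_int (2 * j + r)\<bar> \<le> L \<longleftrightarrow> j \<in> {\<lceil>x\<rceil>..\<lfloor>y\<rfloor>}" for j
  proof -
    have "\<bar>of_int (2 * j + r)\<bar> \<le> L \<longleftrightarrow> x \<le> of_int j \<and> of_int j \<le> y"
      by (auto simp: x_def y_def abs_le_iff field_simps)
    then show ?thesis by (auto simp: ceiling_le_iff le_floor_iff)
  qed
  have eq: "{l. even (l - r) \<and> \<bar>of_int l\<bar> \<le> L} = (\<lambda>j. 2 * j + r) ` {\<lceil>x\<rceil>..\<lfloor>y\<rfloor>}"
    by (rule parity_class_eq_image) (rule iff)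
  show "finite {l. even (l - r) \<and> \<bar>of_int l\<bar> \<le> L}" unfolding eq by simp
  have "card {l. even (l - r) \<and> \<bar>of_int l\<bar> \<le> L} = nat (\<lfloor>y\<rfloor> - \<lceil>x\<rceil> + 1)"
    unfolding eq by (subst card_image) (auto simp: inj_on_def)
  moreover have "y - x = L" by (simp add: x_def y_def field_simps)
  ultimately show "\<bar>real (card {l. even (l - r) \<and> \<bar>of_int l\<bar> \<le> L}) - L\<bar> \<le> 1"
    using L by linarith
qed

text \<open>The strict version counts the inner part that \<open>card_parity_class_annulus\<close>
  removes; floor + 1 and ceiling - 1 are the extreme integers strictly inside.\<close>

lemma card_parity_class_open:
  fixes L :: real and r :: int
  assumes L: "L \<ge> 0"
  shows "\<bar>real (card {l. even (l - r) \<and> \<bar>of_int l\<bar> < L}) - L\<bar> \<le> 1"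
proof -
  define x y where "x = (- L - of_int r) / 2" and "y = (L - of_int r) / 2"
  have iff: "\<bar>of_int (2 * j + r)\<bar> < L \<longleftrightarrow> j \<in> {\<lfloor>x\<rfloor> + 1..\<lceil>y\<rceil> - 1}" for j
  proof -
    have "\<bar>of_int (2 * j + r)\<bar> < L \<longleftrightarrow> x < of_int j \<and> of_int j < y"
      by (auto simp: x_def y_def abs_less_iff field_simps)
    also have "\<dots> \<longleftrightarrow> \<lfloor>x\<rfloor> < j \<and> j < \<lceil>y\<rceil>" by (simp only: floor_less_iff less_ceiling_iff)
    finally show ?thesis by auto
  qed
  have eq: "{l. even (l - r) \<and> \<bar>of_int l\<bar> < L} = (\<lambda>j. 2 * j + r) ` {\<lfloor>x\<rfloor> + 1..\<lceil>y\<rceil> - 1}"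
    by (rule parity_class_eq_image) (rule iff)
  have "card {l. even (l - r) \<and> \<bar>of_int l\<bar> < L} = nat (\<lceil>y\<rceil> - 1 - (\<lfloor>x\<rfloor> + 1) + 1)"
    unfolding eq by (subst card_image) (auto simp: inj_on_def)
  moreover have "y - x = L" by (simp add: x_def y_def field_simps)
  ultimately show "\<bar>real (card {l. even (l - r) \<and> \<bar>of_int l\<bar> < L}) - L\<bar> \<le> 1"
    using L by linarith
qed

lemma card_parity_class_annulus:
  fixes L1 L2 :: real and r :: int
  assumes "0 \<le> L1" "L1 \<le> L2"
  shows "\<bar>real (card {l. even (l - r) \<and> L1 \<le> \<bar>of_int l\<bar> \<and> \<bar>of_int l\<bar> \<le> L2}) - (L2 - L1)\<bar> \<le> 2"
proof -
  define A where "A = {l. even (l - r) \<and> \<bar>of_int l\<bar> \<le> L2}"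
  define B where "B = {l. even (l - r) \<and> \<bar>of_int l\<bar> < L1}"
  have BA: "B \<subseteq> A" "finite A"
    using assms card_parity_class_closed(2)[of L2 r] by (auto simp: A_def B_def)
  have eq: "{l. even (l - r) \<and> L1 \<le> \<bar>of_int l\<bar> \<and> \<bar>of_int l\<bar> \<le> L2} = A - B"
    by (auto simp: A_def B_def)
  have "real (card (A - B)) = real (card A) - real (card B)"
    using BA by (simp add: card_Diff_subset card_mono finite_subset of_nat_diff)
  moreover have "\<bar>real (card A) - L2\<bar> \<le> 1" "\<bar>real (card B) - L1\<bar> \<le> 1"
    using card_parity_class_closed(1)[of L2 r] card_parity_class_open[of L1 r] assms
    by (auto simp: A_def B_def)
  ultimately show ?thesis unfolding eq by linarith
qed

text \<open>The root is the half-chord of a circle of radius A at distance k from its centre;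
  \<open>max 0\<close> covers lines that miss the circle.\<close>

lemma sqrt_diff_squares_bounds:
  fixes A k :: real
  assumes "A \<ge> 0" "k \<ge> 0"
  shows "A - k \<le> sqrt (max 0 (A\<^sup>2 - k\<^sup>2))" "sqrt (max 0 (A\<^sup>2 - k\<^sup>2)) \<le> A"
proof -
  show "sqrt (max 0 (A\<^sup>2 - k\<^sup>2)) \<le> A" using assms by (intro real_le_lsqrt) auto
  show "A - k \<le> sqrt (max 0 (A\<^sup>2 - k\<^sup>2))"
  proof (cases "k \<le> A")
    case True
    then have "k * k \<le> A * k" using assms by (intro mult_right_mono)
    then have "(A - k)\<^sup>2 \<le> A\<^sup>2 - k\<^sup>2" by (simp add: power2_eq_square algebra_simps)
    then show ?thesis by (intro real_le_rsqrt) simp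
  next
    case False
    then have "A - k \<le> 0" by simp
    also have "0 \<le> sqrt (max 0 (A\<^sup>2 - k\<^sup>2))" by simp
    finally show ?thesis .
  qed
qed

text \<open>The half-chords bounding \<bar>l\<bar> fall short of the radii by at most k each, so
  their difference is within k of A2 - A1. Counting adds an error 2, and 2 + k \<le> 3 k.\<close>

lemma card_arc:
  fixes A1 A2 :: real and k :: nat and r :: int
  assumes A: "0 \<le> A1" "A1 \<le> A2" and k: "0 < k" "real k \<le> A2"
  defines "S \<equiv> {l. even (l - r) \<and> A1\<^sup>2 \<le> real k ^ 2 + of_int l ^ 2 \<and> real k ^ 2 + of_int l ^ 2 \<le> A2\<^sup>2}"
  shows "\<bar>real (card S) - (A2 - A1)\<bar> \<le> 3 * real k" "finite S"
proof -
  define L where "L = (\<lambda>A. sqrt (max 0 (A\<^sup>2 - real k ^ 2)))"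
  have "real k ^ 2 \<le> A2 ^ 2" using k by (intro power_mono) auto
  then have up: "real k ^ 2 + of_int l ^ 2 \<le> A2\<^sup>2 \<longleftrightarrow> \<bar>of_int l\<bar> \<le> L A2" for l :: int
    using real_sqrt_le_iff[of "of_int l ^ 2" "A2\<^sup>2 - real k ^ 2"] by (auto simp: L_def max_def)
  have low: "A1\<^sup>2 \<le> real k ^ 2 + of_int l ^ 2 \<longleftrightarrow> L A1 \<le> \<bar>of_int l\<bar>" for l :: int
  proof -
    have "A1\<^sup>2 \<le> real k ^ 2 + of_int l ^ 2 \<longleftrightarrow> max 0 (A1\<^sup>2 - real k ^ 2) \<le> of_int l ^ 2" by auto
    also have "\<dots> \<longleftrightarrow> L A1 \<le> \<bar>of_int l\<bar>" unfolding L_def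
      using real_sqrt_le_iff[of "max 0 (A1\<^sup>2 - real k ^ 2)" "of_int l ^ 2"] by simp
    finally show ?thesis .
  qed
  have S: "S = {l. even (l - r) \<and> L A1 \<le> \<bar>of_int l\<bar> \<and> \<bar>of_int l\<bar> \<le> L A2}"
    unfolding S_def up low ..
  have "A1\<^sup>2 \<le> A2\<^sup>2" using A by (intro power_mono)
  then have L: "0 \<le> L A1" "L A1 \<le> L A2" by (auto simp: L_def)
  show "finite S" unfolding S
    by (rule finite_subset[OF _ card_parity_class_closed(2)[of "L A2" r]]) (use L in auto)
  have "\<bar>real (card S) - (L A2 - L A1)\<bar> \<le> 2"
    unfolding S by (rule card_parity_class_annulus[OF L])
  moreover have "A1 - real k \<le> L A1" "L A1 \<le> A1" "A2 - real k \<le> L A2" "L A2 \<le> A2"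
    unfolding L_def using A by (intro sqrt_diff_squares_bounds; simp)+
  ultimately show "\<bar>real (card S) - (A2 - A1)\<bar> \<le> 3 * real k" using k by linarith
qed

section \<open>Parametrization of close pairs by a primitive vector and two integers\<close>

lemma le_powr_iff:
  fixes x R e :: real
  assumes "x > 0" "R > 0" "e > 0"
  shows "x \<le> R powr e \<longleftrightarrow> x powr (1 / e) \<le> R"
proof -
  have "x = (x powr (1 / e)) powr e" using assms by (simp add: powr_powr)
  then have "x \<le> R powr e \<longleftrightarrow> (x powr (1 / e)) powr e \<le> R powr e" by simp
  also have "\<dots> \<longleftrightarrow> x powr (1 / e) \<le> R" using assms by (meson not_le powr_ge_zero powr_less_mono2 powr_mono2 less_imp_le)
  finally show ?thesis .
qed

text \<open>For primitive \<open>v = (a, b)\<close>, integrality of both points \<open>(l (- b, a) \<plusminus> k (a, b)) / 2\<close>.\<close>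

definition parity_ok :: "int \<times> int \<Rightarrow> nat \<Rightarrow> int \<Rightarrow> bool" where
  "parity_ok v k l \<longleftrightarrow> (if even (fst v + snd v) then even (l - int k) else even k \<and> even l)"

text \<open>The common norm of both points: v and its quarter turn are orthogonal and have the same
  length.\<close>

definition height :: "int \<times> int \<Rightarrow> nat \<Rightarrow> int \<Rightarrow> real" where
  "height v k l = len v / 2 * sqrt (real k ^ 2 + of_int l ^ 2)"

text \<open>k > 0 fixes the sign of v and so makes the representation unique; l takes both
  signs.\<close>

definition triples :: "real \<Rightarrow> real \<Rightarrow> real \<Rightarrow> (((int \<times> int) \<times> nat) \<times> int) set" where
  "triples C \<delta> N = {((v, k), l). coprime (fst v) (snd v) \<and> k > 0 \<and> parity_ok v k l \<and>
     (height v k l)\<^sup>2 \<le> N \<and> real k * len v \<le> C * height v k l powr (1 - 2 * \<delta>)}"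

text \<open>The halves are taken in the reals; \<open>parity_ok\<close> makes them integers.\<close>

definition pair_of :: "((int \<times> int) \<times> nat) \<times> int \<Rightarrow> (real \<times> real) \<times> (real \<times> real)" where
  "pair_of = (\<lambda>(((a, b), k), l).
     ((of_int (int k * a - l * b) / 2, of_int (int k * b + l * a) / 2),
      (of_int (- int k * a - l * b) / 2, of_int (l * a - int k * b) / 2)))"

lemma norm_pair_of:
  assumes "pair_of ((v, k), l) = (x, y)"
  shows "norm x = height v k l" "norm y = height v k l" "norm (x - y) = real k * len v"
proof -
  obtain a b where v: "v = (a, b)" by (cases v)
  have x: "x = (of_int (int k * a - l * b) / 2, of_int (int k * b + l * a) / 2)"
    and y: "y = (of_int (- int k * a - l * b) / 2, of_int (l * a - int k * b) / 2)"
    using assms by (auto simp: pair_of_def v)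
  have h: "height v k l = sqrt (of_int (sqn v) * (real k ^ 2 + of_int l ^ 2) / 4)"
    by (simp add: height_def len_def real_sqrt_mult real_sqrt_divide)
  show "norm x = height v k l" "norm y = height v k l"
    unfolding h x y norm_Pair
    by (auto simp: sqn_def v power2_eq_square field_simps)
  have "norm (x - y) = sqrt ((real k * of_int a)\<^sup>2 + (real k * of_int b)\<^sup>2)"
    unfolding x y by (simp add: norm_Pair field_simps)
  also have "\<dots> = len (int k * fst v, int k * snd v)" by (simp add: len_def sqn_def v)
  also have "\<dots> = real k * len v" by (simp only: len_scale of_int_of_nat_eq abs_of_nat)
  finally show "norm (x - y) = real k * len v" .
qed

text \<open>Coprimality lets a divide d, and the quotient is l.\<close>

lemma orthogonal_to_primitive:
  fixes a b c d :: int
  assumes "coprime a b" "a * c + b * d = 0"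
  obtains l where "c = - l * b" "d = l * a"
proof (cases "a = 0")
  case True
  then have b: "b * b = 1" using assms by (simp add: zmult_eq_1_iff) auto
  with True assms have "d = 0" by auto
  \<comment> \<open>b is 1 or -1, its own inverse, so c = - l b is solved by l = - c b.\<close>
  with True b that[of "- c * b"] show ?thesis by (simp add: mult.assoc)
next
  case False
  have "a dvd b * d" using assms(2) by (metis dvd_triv_left dvd_add_right_iff dvd_0_right)
  then have "a dvd d" using assms(1) by (simp add: coprime_dvd_mult_right_iff)
  then obtain l where l: "d = l * a" by (metis dvdE mult.commute)
  have "a * (c + l * b) = 0" using assms(2) l by (simp add: algebra_simps)
  with False have "c = - l * b" by simp
  with l that show ?thesis by blast
qed

text \<open>Difference and sum of the two points recover k (a, b) and l (- b, a), which gives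
  injectivity. Conversely, the primitive part of the difference gives v and k, and equal norms make
  the sum orthogonal to v, which gives l.\<close>

lemma bij_betw_pair_of: "bij_betw pair_of (triples C \<delta> N) (close_pairs C \<delta> N)"
  unfolding bij_betw_def
proof
  show "inj_on pair_of (triples C \<delta> N)"
  proof (rule inj_onI, clarify)
    fix a b k l a' b' k' l'
    assume t: "(((a, b), k), l) \<in> triples C \<delta> N" "(((a', b'), k'), l') \<in> triples C \<delta> N"
      and eq: "pair_of (((a, b), k), l) = pair_of (((a', b'), k'), l')"
    have e1: "int k * a - l * b = int k' * a' - l' * b'" "int k * b + l * a = int k' * b' + l' * a'"
      "- int k * a - l * b = - int k' * a' - l' * b'" "l * a - int k * b = l' * a' - int k' * b'"
      using eq unfolding pair_of_def prod.case prod.inject divide_cancel_right of_int_eq_iff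
      by simp_all
    then have e2: "int k * a = int k' * a'" "int k * b = int k' * b'" "l * a = l' * a'" "l * b = l' * b'"
      by linarith+
    have c: "coprime a b" "coprime a' b'" "k > 0" "k' > 0" using t by (auto simp: triples_def)
    have "k = k'" "a = a'" "b = b'"
      by (rule primitive_decomposition_unique[OF e2(1,2) c(3,4) c(1,2)])+
    moreover have "a \<noteq> 0 \<or> b \<noteq> 0" using c(1) by auto
    ultimately show "((a, b), k) = ((a', b'), k') \<and> l = l'" using e2(3,4) by auto
  qed
  show "pair_of ` triples C \<delta> N = close_pairs C \<delta> N"
  proof (intro subset_antisym subsetI)
    fix q assume "q \<in> pair_of ` triples C \<delta> N"
    then obtain a b k l where t: "(((a, b), k), l) \<in> triples C \<delta> N" and q: "q = pair_of (((a, b), k), l)"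
      by auto
    obtain x y where xy: "q = (x, y)" by (cases q)
    have "pair_of (((a, b), k), l) = (x, y)" using q xy by simp
    note n = norm_pair_of[OF this]
    have par: "parity_ok (a, b) k l" "coprime a b" "k > 0" using t by (auto simp: triples_def)
    \<comment> \<open>Hence a + b is even only if both are odd, and \<open>parity_ok\<close> makes
      all four numerators even.\<close>
    have "odd a \<or> odd b" using par(2) by (metis coprime_common_divisor odd_one)
    then have "even (int k * a - l * b)" "even (int k * b + l * a)" "even (- int k * a - l * b)" "even (l * a - int k * b)"
      using par(1) by (auto simp: parity_ok_def split: if_splits)
    moreover have "of_int z / 2 \<in> (\<int> :: real set)" if "even z" for z :: int using that by auto
    moreover have "x = (of_int (int k * a - l * b) / 2, of_int (int k * b + l * a) / 2)"
      "y = (of_int (- int k * a - l * b) / 2, of_int (l * a - int k * b) / 2)"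
      using q xy unfolding pair_of_def prod.case prod.inject by blast+
    ultimately have "x \<in> int_lattice" "y \<in> int_lattice" unfolding int_lattice_def by blast+
    moreover have "len (a, b) > 0" using par(2) by (intro len_pos) auto
    then have "norm (x - y) > 0" unfolding n using par(3) by simp
    then have "x \<noteq> y" by auto
    ultimately show "q \<in> close_pairs C \<delta> N"
      using t par(3) unfolding xy close_pairs_def triples_def by (auto simp: n)
  next
    fix q assume q: "q \<in> close_pairs C \<delta> N"
    then obtain x1 x2 y1 y2 where xy: "q = ((of_int x1, of_int x2), (of_int y1, of_int y2))"
      unfolding close_pairs_def int_lattice_def by (auto elim!: Ints_cases)
    have "norm (of_int x1 :: real, of_int x2 :: real) ^ 2 = norm (of_int y1 :: real, of_int y2 :: real) ^ 2"
      using q unfolding xy close_pairs_def by auto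
    then have "of_int (x1 ^ 2 + x2 ^ 2) = (of_int (y1 ^ 2 + y2 ^ 2) :: real)"
      by (simp add: norm_Pair)
    then have sq: "x1 ^ 2 + x2 ^ 2 = y1 ^ 2 + y2 ^ 2" by (simp only: of_int_eq_iff)
    have "(x1 - y1, x2 - y2) \<noteq> (0, 0)" using q unfolding xy close_pairs_def by auto
    then obtain k w where kw: "k > 0" "coprime (fst w) (snd w)"
        "(x1 - y1, x2 - y2) = (int k * fst w, int k * snd w)"
      by (rule primitive_decomposition)
    obtain a b where w: "w = (a, b)" by (cases w)
    have m: "x1 - y1 = int k * a" "x2 - y2 = int k * b" and cop: "coprime a b" using kw w by auto
    have "int k * (a * (x1 + y1) + b * (x2 + y2)) = (x1 - y1) * (x1 + y1) + (x2 - y2) * (x2 + y2)"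
      unfolding m by (simp add: algebra_simps)
    also have "\<dots> = 0" using sq by (simp add: algebra_simps power2_eq_square)
    finally have "a * (x1 + y1) + b * (x2 + y2) = 0" using kw(1) by simp
    then obtain l where l: "x1 + y1 = - l * b" "x2 + y2 = l * a"
      using orthogonal_to_primitive[OF cop] by blast
    \<comment> \<open>If exactly one of a, b is odd, even numerators force k and l to be even; if
      both are odd, they force k and l to have equal parity.\<close>
    have "odd a \<or> odd b" using cop by (metis coprime_common_divisor odd_one)
    moreover have "even (int k * a - l * b)" "even (int k * b + l * a)"
    proof -
      have "int k * a - l * b = 2 * x1" "int k * b + l * a = 2 * x2" using m l by linarith+
      then show "even (int k * a - l * b)" "even (int k * b + l * a)" by simp_all
    qed
    ultimately have par: "parity_ok w k l" unfolding parity_ok_def w by auto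
    have "int k * a - l * b = 2 * x1" "int k * b + l * a = 2 * x2"
      "- int k * a - l * b = 2 * y1" "l * a - int k * b = 2 * y2" using m l by linarith+
    then have pq: "pair_of ((w, k), l) = q" unfolding pair_of_def w xy prod.case by simp
    have "((w, k), l) \<in> triples C \<delta> N"
      using q norm_pair_of[OF pq[unfolded xy]] kw par unfolding xy close_pairs_def triples_def by auto
    then show "q \<in> pair_of ` triples C \<delta> N" using pq by blast
  qed
qed

section \<open>Counting for a fixed primitive direction\<close>

lemma sum_even_terms:
  fixes f :: "nat \<Rightarrow> real"
  shows "(\<Sum>k=1..n. if even k then f k else 0) = (\<Sum>j=1..n div 2. f (2 * j))"
proof (induction n)
  case (Suc n)
  show ?case
  proof (cases "even n")
    case True
    then have "Suc n div 2 = n div 2" by simp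
    with True Suc show ?thesis by simp
  next
    case False
    then have "Suc n div 2 = Suc (n div 2)" "2 * Suc (n div 2) = Suc n" by presburger+
    with False Suc show ?thesis by (simp del: mult_Suc_right)
  qed
qed simp

text \<open>Holds exactly when some l satisfies \<open>parity_ok v k l\<close>; those l then form a
  single parity class.\<close>

definition good :: "int \<times> int \<Rightarrow> nat \<Rightarrow> bool" where
  "good v k \<longleftrightarrow> even (fst v + snd v) \<or> even k"

text \<open>If only even k = 2 j count, the sum is the full one with x / 2 in place of x, whence the
  weight 1/2.\<close>

lemma sum_good:
  fixes x \<alpha> :: real
  assumes x: "x > 0" and \<alpha>: "\<alpha> > 0"
  shows "\<bar>(\<Sum>k=1..nat \<lfloor>x\<rfloor>. if good v k then 1 - (real k / x) powr \<alpha> else 0)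
    - weight v * (x * \<alpha> / (\<alpha> + 1))\<bar> \<le> 1"
proof (cases "even (fst v + snd v)")
  case True
  then show ?thesis using sum_one_minus_powr_bounds[OF x \<alpha>] by (simp add: good_def weight_def)
next
  case False
  have "\<lfloor>x / 2\<rfloor> = \<lfloor>x\<rfloor> div 2" using floor_divide_real_eq_div[of 2 x] by simp
  then have n: "nat \<lfloor>x / 2\<rfloor> = nat \<lfloor>x\<rfloor> div 2" using x by (simp add: nat_div_distrib)
  have "(\<Sum>k=1..nat \<lfloor>x\<rfloor>. if good v k then 1 - (real k / x) powr \<alpha> else 0) =
    (\<Sum>k=1..nat \<lfloor>x\<rfloor>. if even k then 1 - (real k / x) powr \<alpha> else 0)"
    using False by (intro sum.cong) (auto simp: good_def)
  also have "\<dots> = (\<Sum>j=1..nat \<lfloor>x / 2\<rfloor>. 1 - (real j / (x / 2)) powr \<alpha>)"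
    unfolding sum_even_terms n by (simp add: mult.commute)
  finally show ?thesis
    using sum_one_minus_powr_bounds[of "x / 2" \<alpha>] x \<alpha> False by (simp add: weight_def)
qed

definition arc_indices :: "real \<Rightarrow> real \<Rightarrow> real \<Rightarrow> int \<times> int \<Rightarrow> nat \<Rightarrow> int set" where
  "arc_indices C \<delta> N v k = {l. parity_ok v k l \<and>
     (height v k l)\<^sup>2 \<le> N \<and> real k * len v \<le> C * height v k l powr (1 - 2 * \<delta>)}"

text \<open>For fixed v and k, closeness bounds the height from below and N bounds it from above, so
  l runs over a parity class in an annulus and \<open>card_arc\<close> applies.\<close>

lemma card_arc_indices:
  fixes C \<delta> N :: real and k :: nat
  assumes \<delta>: "\<delta> < 1 / 2" and C: "0 < C" and N: "0 < N"
  defines "X \<equiv> C * sqrt N powr (1 - 2 * \<delta>)"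
  assumes XN: "X \<le> 2 * sqrt N" and v: "v \<noteq> (0, 0)" and k: "k > 0" "real k * len v \<le> X"
  shows "\<bar>real (card (arc_indices C \<delta> N v k)) -
      2 * sqrt N / len v * (if good v k then 1 - (real k / (X / len v)) powr (1 / (1 - 2 * \<delta>)) else 0)\<bar>
      \<le> 3 * real k"
    and "finite (arc_indices C \<delta> N v k)"
proof -
  define e where "e = 1 - 2 * \<delta>"
  define p where "p = len v"
  have e: "e > 0" using \<delta> by (simp add: e_def)
  have p: "p > 0" using len_pos[OF v] by (simp add: p_def)
  have sN: "sqrt N > 0" using N by simp
  have X: "X > 0" using C N by (simp add: X_def)
  \<comment> \<open>The least admissible height: as e > 0, k p \<le> C R^e means R \<ge> T. At k p =
    X it equals sqrt N.\<close>
  define T where "T = (real k * p / C) powr (1 / e)"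
  have Teq: "T = sqrt N * (real k / (X / p)) powr (1 / e)"
  proof -
    have "real k * p / C = (real k / (X / p)) * (sqrt N powr e)"
      using C sN p by (simp add: X_def e_def)
    moreover have "(real k / (X / p) * sqrt N powr e) powr (1 / e) =
        (real k / (X / p)) powr (1 / e) * (sqrt N powr e) powr (1 / e)"
      by (rule powr_mult)
    ultimately have "T = (real k / (X / p)) powr (1 / e) * (sqrt N powr e) powr (1 / e)"
      unfolding T_def by (simp only:)
    then show ?thesis using e sN by (simp add: powr_powr)
  qed
  have iff: "real k * p \<le> C * R powr e \<longleftrightarrow> T \<le> R" if "R > 0" for R
    using le_powr_iff[of "real k * p / C" R e] that e k(1) p C by (simp add: T_def field_simps)
  have TN: "T \<le> sqrt N" using iff[OF sN] k(2) unfolding X_def e_def p_def by simp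
  define A1 A2 where "A1 = 2 * T / p" and "A2 = 2 * sqrt N / p"
  \<comment> \<open>k \<le> A2 holds because k \<le> X / p and X \<le> 2 sqrt N.\<close>
  have A: "0 \<le> A1" "A1 \<le> A2" "real k \<le> A2"
    using TN p k(2) XN by (auto simp: A1_def A2_def T_def field_simps p_def)
  have hp: "height v k l > 0" for l using p k by (simp add: height_def p_def add_pos_nonneg)
  have up: "(height v k l)\<^sup>2 \<le> N \<longleftrightarrow> real k ^ 2 + of_int l ^ 2 \<le> A2\<^sup>2" for l
    using p N by (simp add: height_def A2_def power_mult_distrib power_divide p_def[symmetric] field_simps)
  have low: "real k * len v \<le> C * height v k l powr (1 - 2 * \<delta>) \<longleftrightarrow> A1\<^sup>2 \<le> real k ^ 2 + of_int l ^ 2" for l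
  proof -
    have "real k * len v \<le> C * height v k l powr (1 - 2 * \<delta>) \<longleftrightarrow> T \<le> height v k l"
      using iff[OF hp, of l] by (simp add: p_def e_def)
    also have "\<dots> \<longleftrightarrow> A1 \<le> sqrt (real k ^ 2 + of_int l ^ 2)"
      using p by (simp add: height_def A1_def p_def[symmetric] field_simps)
    also have "\<dots> \<longleftrightarrow> sqrt (A1\<^sup>2) \<le> sqrt (real k ^ 2 + of_int l ^ 2)" using A by simp
    also have "\<dots> \<longleftrightarrow> A1\<^sup>2 \<le> real k ^ 2 + of_int l ^ 2" by (rule real_sqrt_le_iff)
    finally show ?thesis .
  qed
  define r where "r = (if even (fst v + snd v) then int k else 0)"
  have par: "parity_ok v k l \<longleftrightarrow> good v k \<and> even (l - r)" for l
    by (auto simp: parity_ok_def good_def r_def)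
  have eq: "arc_indices C \<delta> N v k = (if good v k then
      {l. even (l - r) \<and> A1\<^sup>2 \<le> real k ^ 2 + of_int l ^ 2 \<and> real k ^ 2 + of_int l ^ 2 \<le> A2\<^sup>2} else {})"
    unfolding arc_indices_def up low par by auto
  note arc = card_arc[OF A(1,2) k(1) A(3), of r]
  show "finite (arc_indices C \<delta> N v k)" unfolding eq using arc(2) by simp
  have "A2 - A1 = 2 * sqrt N / p * (1 - (real k / (X / p)) powr (1 / e))"
    unfolding A1_def A2_def Teq using p by (simp add: field_simps)
  then show "\<bar>real (card (arc_indices C \<delta> N v k)) -
      2 * sqrt N / len v * (if good v k then 1 - (real k / (X / len v)) powr (1 / (1 - 2 * \<delta>)) else 0)\<bar>
      \<le> 3 * real k"
    unfolding eq e_def[symmetric] p_def[symmetric] using arc(1) by simp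
qed

section \<open>Summation over primitive directions\<close>

text \<open>A height of at most sqrt N turns closeness into k \<open>len v\<close> \<le> X, which
  bounds both v and k.\<close>

lemma triples_eq_Sigma:
  fixes C \<delta> N :: real
  assumes \<delta>: "\<delta> < 1 / 2" and C: "0 < C"
  defines "X \<equiv> C * sqrt N powr (1 - 2 * \<delta>)"
  shows "triples C \<delta> N =
    Sigma (Sigma (prim X) (\<lambda>v. {1..nat \<lfloor>X / len v\<rfloor>})) (\<lambda>(v, k). arc_indices C \<delta> N v k)"
proof -
  have *: "v \<in> prim X \<and> k \<le> nat \<lfloor>X / len v\<rfloor>"
    if "coprime (fst v) (snd v)" "k > 0" "l \<in> arc_indices C \<delta> N v k" for v k l
  proof -
    have p: "len v > 0" using that(1) by (intro len_pos) auto
    have "height v k l \<ge> 0" by (simp add: height_def)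
    moreover have "(height v k l)\<^sup>2 \<le> N" using that by (simp add: arc_indices_def)
    ultimately have "height v k l \<le> sqrt N" by (intro real_le_rsqrt)
    then have "height v k l powr (1 - 2 * \<delta>) \<le> sqrt N powr (1 - 2 * \<delta>)"
      using \<delta> \<open>height v k l \<ge> 0\<close> by (intro powr_mono2) auto
    then have "C * height v k l powr (1 - 2 * \<delta>) \<le> X" unfolding X_def using C by simp
    then have kX: "real k * len v \<le> X" using that by (simp add: arc_indices_def)
    then have "real k \<le> X / len v" using p by (simp add: field_simps)
    then have "k \<le> nat \<lfloor>X / len v\<rfloor>" by linarith
    moreover have "len v \<le> real k * len v" using that(2) p by (simp add: mult_le_cancel_right1)
    with kX have "v \<in> prim X" using that(1) by (simp add: prim_def)
    ultimately show ?thesis by blast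
  qed
  show ?thesis
  proof (intro set_eqI iffI)
    fix t assume t: "t \<in> triples C \<delta> N"
    obtain v k l where vkl: "t = ((v, k), l)" by (metis surj_pair)
    have "coprime (fst v) (snd v)" "k > 0" "l \<in> arc_indices C \<delta> N v k"
      using t by (auto simp: vkl triples_def arc_indices_def)
    with *[OF this] show "t \<in> Sigma (Sigma (prim X) (\<lambda>v. {1..nat \<lfloor>X / len v\<rfloor>})) (\<lambda>(v, k). arc_indices C \<delta> N v k)"
      by (simp add: vkl)
  next
    fix t assume t: "t \<in> Sigma (Sigma (prim X) (\<lambda>v. {1..nat \<lfloor>X / len v\<rfloor>})) (\<lambda>(v, k). arc_indices C \<delta> N v k)"
    obtain v k l where vkl: "t = ((v, k), l)" by (metis surj_pair)
    show "t \<in> triples C \<delta> N"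
      using t by (simp add: vkl triples_def arc_indices_def prim_def)
  qed
qed

text \<open>The first error collects the error 1 of \<open>sum_good\<close> times 2 sqrt N /
  \<open>len v\<close>, the second the counting errors 3 k of
  \<open>card_arc_indices\<close>.\<close>

lemma Bstar_approx:
  fixes C \<delta> N :: real
  assumes \<delta>: "\<delta> < 1 / 2" and C: "0 < C" and N: "0 < N"
  defines "X \<equiv> C * sqrt N powr (1 - 2 * \<delta>)"
  assumes XN: "X \<le> 2 * sqrt N"
  shows "\<bar>real (Bstar C \<delta> N) - sqrt N * X / (1 - \<delta>) * weighted_sum X\<bar>
    \<le> 2 * sqrt N * (\<Sum>v\<in>prim X. 1 / len v) + 3 * X\<^sup>2 * invsq_sum (prim X)"
proof -
  define \<alpha> where "\<alpha> = 1 / (1 - 2 * \<delta>)"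
  have \<alpha>: "\<alpha> > 0" using \<delta> by (simp add: \<alpha>_def)
  have \<alpha>1: "\<alpha> / (\<alpha> + 1) = 1 / (2 * (1 - \<delta>))" using \<delta> by (simp add: \<alpha>_def field_simps)
  have X: "X > 0" using C N by (simp add: X_def)
  define n where "n v = nat \<lfloor>X / len v\<rfloor>" for v
  define c where "c v k = real (card (arc_indices C \<delta> N v k))" for v k
  define m where "m v k = (if good v k then 1 - (real k / (X / len v)) powr \<alpha> else 0)" for v k
  have vk: "v \<noteq> (0, 0)" "len v > 0" if "v \<in> prim X" for v
  proof -
    show "v \<noteq> (0, 0)" using that by (auto simp: prim_def)
    then show "len v > 0" by (rule len_pos)
  qed
  have nX: "real (n v) \<le> X / len v" if "v \<in> prim X" for v
    unfolding n_def using X vk[OF that] by (simp add: of_nat_floor)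
  have arc: "\<bar>c v k - 2 * sqrt N / len v * m v k\<bar> \<le> 3 * real k \<and> finite (arc_indices C \<delta> N v k)"
    if "v \<in> prim X" "k \<in> {1..n v}" for v k
  proof -
    have "real k \<le> X / len v" using nX[OF that(1)] that(2) by simp
    then have "real k * len v \<le> X" using vk[OF that(1)] by (simp add: field_simps)
    then show ?thesis
      using card_arc_indices[OF \<delta> C N, of v k] XN vk[OF that(1)] that(2)
      unfolding X_def[symmetric] c_def m_def \<alpha>_def by simp
  qed
  have row: "\<bar>(\<Sum>k=1..n v. c v k) - sqrt N * X / (1 - \<delta>) * (weight v / len v ^ 2)\<bar>
      \<le> 2 * sqrt N * (1 / len v) + 3 * X\<^sup>2 * (1 / len v ^ 2)" if v: "v \<in> prim X" for v
  proof -
    note p = vk(2)[OF v]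
    have "\<bar>(\<Sum>k=1..n v. c v k) - (\<Sum>k=1..n v. 2 * sqrt N / len v * m v k)\<bar>
        \<le> (\<Sum>k=1..n v. \<bar>c v k - 2 * sqrt N / len v * m v k\<bar>)"
      unfolding sum_subtractf[symmetric] by (rule sum_abs)
    \<comment> \<open>Bounding each k by n v \<le> X / \<open>len v\<close> gives 3 (X /
      \<open>len v\<close>)^2 in all.\<close>
    also have "\<dots> \<le> (\<Sum>k=1..n v. 3 * real (n v))"
      using arc[OF v] by (intro sum_mono) fastforce
    also have "\<dots> = 3 * real (n v) ^ 2" by (simp add: power2_eq_square)
    also have "\<dots> \<le> 3 * (X / len v) ^ 2"
      using nX[OF v] by (intro mult_left_mono power_mono) auto
    finally have 1: "\<bar>(\<Sum>k=1..n v. c v k) - (\<Sum>k=1..n v. 2 * sqrt N / len v * m v k)\<bar>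
        \<le> 3 * X\<^sup>2 * (1 / len v ^ 2)" by (simp add: power_divide)
    have "\<bar>(\<Sum>k=1..n v. m v k) - weight v * (X / len v * \<alpha> / (\<alpha> + 1))\<bar> \<le> 1"
      unfolding m_def n_def using X p \<alpha> by (intro sum_good) auto
    then have "2 * sqrt N / len v * \<bar>(\<Sum>k=1..n v. m v k) - weight v * (X / len v * \<alpha> / (\<alpha> + 1))\<bar>
        \<le> 2 * sqrt N / len v * 1"
      using p N by (intro mult_left_mono) auto
    then have "\<bar>2 * sqrt N / len v * ((\<Sum>k=1..n v. m v k) - weight v * (X / len v * \<alpha> / (\<alpha> + 1)))\<bar>
        \<le> 2 * sqrt N * (1 / len v)"
      using p N by (simp add: abs_mult)
    also have "2 * sqrt N / len v * ((\<Sum>k=1..n v. m v k) - weight v * (X / len v * \<alpha> / (\<alpha> + 1)))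
      = (\<Sum>k=1..n v. 2 * sqrt N / len v * m v k) - 2 * sqrt N / len v * (weight v * (X / len v * (\<alpha> / (\<alpha> + 1))))"
      by (simp add: right_diff_distrib sum_distrib_left)
    also have "2 * sqrt N / len v * (weight v * (X / len v * (\<alpha> / (\<alpha> + 1))))
      = sqrt N * X / (1 - \<delta>) * (weight v / len v ^ 2)"
      unfolding \<alpha>1 using p \<delta> by (simp add: field_simps power2_eq_square)
    finally show ?thesis using 1 by linarith
  qed
  have "Bstar C \<delta> N = card (triples C \<delta> N)"
    unfolding Bstar_def by (rule bij_betw_same_card[OF bij_betw_pair_of, symmetric])
  also have "\<dots> = (\<Sum>vk\<in>Sigma (prim X) (\<lambda>v. {1..n v}). card (case vk of (v, k) \<Rightarrow> arc_indices C \<delta> N v k))"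
    unfolding triples_eq_Sigma[OF \<delta> C] X_def[symmetric] n_def[symmetric]
    using arc by (intro card_SigmaI) auto
  also have "\<dots> = (\<Sum>v\<in>prim X. \<Sum>k=1..n v. card (arc_indices C \<delta> N v k))"
    by (subst sum.Sigma) (auto intro!: sum.cong)
  finally have B: "real (Bstar C \<delta> N) = (\<Sum>v\<in>prim X. \<Sum>k=1..n v. c v k)" by (simp add: c_def)
  have "real (Bstar C \<delta> N) - sqrt N * X / (1 - \<delta>) * weighted_sum X =
      (\<Sum>v\<in>prim X. (\<Sum>k=1..n v. c v k) - sqrt N * X / (1 - \<delta>) * (weight v / len v ^ 2))"
    unfolding B weighted_sum_def sum_subtractf sum_distrib_left ..
  also have "\<bar>\<dots>\<bar> \<le> (\<Sum>v\<in>prim X. \<bar>(\<Sum>k=1..n v. c v k) - sqrt N * X / (1 - \<delta>) * (weight v / len v ^ 2)\<bar>)"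
    by (rule sum_abs)
  also have "\<dots> \<le> (\<Sum>v\<in>prim X. 2 * sqrt N * (1 / len v) + 3 * X\<^sup>2 * (1 / len v ^ 2))"
    by (intro sum_mono row)
  also have "\<dots> = 2 * sqrt N * (\<Sum>v\<in>prim X. 1 / len v) + 3 * X\<^sup>2 * invsq_sum (prim X)"
    unfolding invsq_sum_def sum.distrib sum_distrib_left ..
  finally show ?thesis .
qed

theorem theorem1p3:
  fixes \<delta> C :: real
  assumes "0 < \<delta>" and "\<delta> < 1 / 2" and "0 < C"
  shows "\<exists>E :: real \<Rightarrow> real.
           E \<in> O[at_top](\<lambda>N. 1 / sqrt (ln N)) \<and>
           (\<forall>\<^sub>F N in at_top.
              real (Bstar C \<delta> N) =
                4 * C / pi * ((1 - 2 * \<delta>) / (1 - \<delta>)) * (N powr (1 - \<delta>) * ln N) * (1 + E N))"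
proof -
  define e where "e = 1 - 2 * \<delta>"
  have e: "0 < e" "e < 1" using assms by (auto simp: e_def)
  define M where "M N = 4 * C / pi * (e / (1 - \<delta>)) * (N powr (1 - \<delta>) * ln N)" for N
  \<comment> \<open>Solved from the claimed identity, so that only M N \<noteq> 0 and the size of E
    remain to be shown.\<close>
  define E where "E N = real (Bstar C \<delta> N) / M N - 1" for N
  define \<kappa> where "\<kappa> = 4 / pi * (e / (1 - \<delta>))"
  have \<kappa>: "\<kappa> > 0" using assms e by (simp add: \<kappa>_def)
  \<comment> \<open>C N^(e/2) is the X of \<open>Bstar_approx\<close>. The last condition, which
    holds eventually since \<delta> > 0, gives X^2 ln N \<le> sqrt N X and so tames the second error
    term.\<close>
  have ev: "\<forall>\<^sub>F N in at_top. 1 < N \<and> 1 \<le> sqrt (ln N) \<and> \<bar>ln C\<bar> \<le> sqrt (ln N) \<and>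
      C * N powr (e / 2) \<le> 2 * sqrt N \<and> 2 \<le> ln (C * N powr (e / 2)) \<and>
      C * N powr (e / 2) \<le> N \<and> C * N powr (- \<delta>) * ln N \<le> 1"
    using assms e by (intro eventually_conj; real_asymp)
  have bound: "M N \<noteq> 0 \<and> \<bar>E N\<bar> \<le> 500 / \<kappa> * (1 / sqrt (ln N))"
    if N: "1 < N" and L1: "1 \<le> sqrt (ln N)" and LC: "\<bar>ln C\<bar> \<le> sqrt (ln N)"
      and X2: "C * N powr (e / 2) \<le> 2 * sqrt N" and lnX2: "2 \<le> ln (C * N powr (e / 2))"
      and XN: "C * N powr (e / 2) \<le> N" and small: "C * N powr (- \<delta>) * ln N \<le> 1" for N
  proof -
    define X where "X = C * N powr (e / 2)"
    define Y where "Y = C * N powr (1 - \<delta>)"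
    define L where "L = sqrt (ln N)"
    define B where "B = real (Bstar C \<delta> N)"
    have Xeq: "C * sqrt N powr (1 - 2 * \<delta>) = X"
      using N by (simp add: X_def e_def powr_half_sqrt[symmetric] powr_powr)
    have X: "X > 0" using assms N by (simp add: X_def)
    have Y: "Y > 0" using assms N by (simp add: Y_def)
    have lnN: "ln N = L\<^sup>2" "ln N > 0" using N by (simp_all add: L_def)
    have L: "L \<ge> 1" using L1 by (simp add: L_def)
    have "1 / 2 + e / 2 = 1 - \<delta>" by (simp add: e_def field_simps)
    then have "sqrt N * N powr (e / 2) = N powr (1 - \<delta>)"
      using N powr_half_sqrt[of N] powr_add[of N "1 / 2" "e / 2"] by simp
    then have Yeq: "sqrt N * X = Y" by (simp add: X_def Y_def)
    have "ln X \<le> ln N" using XN X N by (simp add: X_def)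
    then have sX: "sqrt (ln X) \<le> L" by (simp add: L_def)
    have lnX: "ln X = ln C + e / 2 * ln N"
      using assms N by (simp add: X_def ln_mult ln_powr)
    have lnX2: "ln X \<ge> 2" using lnX2 by (simp add: X_def)
    have "N powr (e / 2) * N powr (e / 2) = N powr (1 - \<delta>) * N powr (- \<delta>)"
      unfolding powr_add[symmetric] by (simp add: e_def)
    then have X2eq: "X\<^sup>2 = Y * (C * N powr (- \<delta>))"
      by (simp add: X_def Y_def power2_eq_square)
    have MY: "M N = Y * \<kappa> * ln N" by (simp add: M_def Y_def \<kappa>_def)
    have M0: "M N > 0" unfolding MY using Y \<kappa> lnN by simp
    \<comment> \<open>8 / pi times the factor e / 2 from ln X = ln C + e / 2 ln N produces the
      constant 4 e / pi.\<close>
    have main: "Y / (1 - \<delta>) * (8 / pi * (e / 2 * ln N)) = M N"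
      unfolding MY \<kappa>_def by (simp add: mult_ac)
    have "\<bar>B - Y / (1 - \<delta>) * weighted_sum X\<bar> \<le>
        2 * sqrt N * (\<Sum>v\<in>prim X. 1 / len v) + 3 * X\<^sup>2 * invsq_sum (prim X)"
      using Bstar_approx[of \<delta> C N] assms N X2 unfolding Xeq Yeq B_def by (simp add: X_def)
    also have "\<dots> \<le> 2 * sqrt N * (30 * X * sqrt (ln X)) + 3 * X\<^sup>2 * (100 * ln X)"
      using sum_inverse_len_prim[of X] X lnX2 N by (intro add_mono mult_left_mono) auto
    also have "\<dots> = 60 * (Y * sqrt (ln X)) + 300 * Y * (C * N powr (- \<delta>) * ln X)"
      unfolding X2eq Yeq[symmetric] by simp
    also have "\<dots> \<le> 60 * (Y * L) + 300 * Y * L"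
    proof (intro add_mono mult_left_mono sX)
      have "C * N powr (- \<delta>) * ln X \<le> C * N powr (- \<delta>) * ln N"
        using assms \<open>ln X \<le> ln N\<close> by (intro mult_left_mono) auto
      then show "C * N powr (- \<delta>) * ln X \<le> L" using small L by linarith
    qed (use Y in auto)
    finally have 1: "\<bar>B - Y / (1 - \<delta>) * weighted_sum X\<bar> \<le> 360 * (Y * L)" by (simp add: mult.commute)
    have "\<bar>weighted_sum X - 8 / pi * ln X\<bar> \<le> 60 * L"
      using weighted_sum_asymp[OF X lnX2] sX by linarith
    moreover have "8 / pi * \<bar>ln C\<bar> \<le> 8 / 3 * L"
      using pi_gt3 LC by (intro mult_mono divide_left_mono) (auto simp: L_def)
    then have "\<bar>8 / pi * ln C\<bar> \<le> 3 * L" using L by (simp add: abs_mult)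
    moreover have "8 / pi * ln X = 8 / pi * ln C + 8 / pi * (e / 2 * ln N)"
      unfolding lnX by (rule distrib_left)
    ultimately have "\<bar>weighted_sum X - 8 / pi * (e / 2 * ln N)\<bar> \<le> 63 * L" by linarith
    \<comment> \<open>1 / (1 - \<delta>) \<le> 2 because \<delta> < 1/2.\<close>
    then have "Y / (1 - \<delta>) * \<bar>weighted_sum X - 8 / pi * (e / 2 * ln N)\<bar> \<le> Y * 2 * (63 * L)"
      using Y assms L by (intro mult_mono) (auto simp: field_simps)
    then have "\<bar>Y / (1 - \<delta>) * (weighted_sum X - 8 / pi * (e / 2 * ln N))\<bar> \<le> 126 * (Y * L)"
      using Y assms by (simp add: abs_mult)
    then have "\<bar>Y / (1 - \<delta>) * weighted_sum X - M N\<bar> \<le> 126 * (Y * L)"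
      unfolding right_diff_distrib main .
    moreover have "Y * L > 0" using Y L by simp
    \<comment> \<open>360 + 126 \<le> 500.\<close>
    ultimately have "\<bar>B - M N\<bar> \<le> 500 * (Y * L)" using 1 by linarith
    then have "\<bar>B - M N\<bar> / M N \<le> 500 * (Y * L) / M N" using M0 by (intro divide_right_mono) auto
    also have "\<dots> = 500 / \<kappa> * (1 / L)"
      unfolding MY lnN(1) using Y L \<kappa> by (simp add: field_simps power2_eq_square)
    also have "\<bar>B - M N\<bar> / M N = \<bar>E N\<bar>"
      unfolding E_def B_def using M0 by (simp add: field_simps abs_divide[symmetric] flip: abs_of_pos)
    finally show ?thesis using M0 unfolding L_def by simp
  qed
  have "\<forall>\<^sub>F N in at_top. M N \<noteq> 0 \<and> \<bar>E N\<bar> \<le> 500 / \<kappa> * (1 / sqrt (ln N))"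
    using ev by eventually_elim (use bound in blast)
  then have ev': "\<forall>\<^sub>F N in at_top. M N \<noteq> 0"
      "\<forall>\<^sub>F N in at_top. \<bar>E N\<bar> \<le> 500 / \<kappa> * (1 / sqrt (ln N))"
    by (auto elim: eventually_mono)
  show ?thesis
  proof (intro exI[of _ E] conjI)
    show "E \<in> O[at_top](\<lambda>N. 1 / sqrt (ln N))"
    proof (rule bigoI[of _ "500 / \<kappa>"])
      show "\<forall>\<^sub>F N in at_top. norm (E N) \<le> 500 / \<kappa> * norm (1 / sqrt (ln N))"
        using ev'(2) ev by eventually_elim simp
    qed
    show "\<forall>\<^sub>F N in at_top. real (Bstar C \<delta> N) =
        4 * C / pi * ((1 - 2 * \<delta>) / (1 - \<delta>)) * (N powr (1 - \<delta>) * ln N) * (1 + E N)"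
      unfolding e_def[symmetric] M_def[symmetric] using ev'(1)
      by eventually_elim (simp add: E_def)
  qed
qed

end
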